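(* Let $\mathbf{S}=(S_1,S_2,S_3,\tilde S_1,\tilde S_2)$ be a $\Gamma_{E(3;2;1,2)}$-contraction on a Hilbert space. The fundamental operators of $\mathbf{S}$ are the unique operators $G_1,\tilde G_2,G_2$ and $\tilde G_1$ on $\mathcal{D}_{S_3}$ which satisfy the operator equations $$D_{S_3}S_1=G_1D_{S_3}+\tilde G_2^*D_{S_3}S_3,\qquad D_{S_3}\tilde S_2=\tilde G_2D_{S_3}+G_1^*D_{S_3}S_3$$ and $$D_{S_3}\tfrac{S_2}{2}=G_2D_{S_3}+\tilde G_1^*D_{S_3}S_3,\qquad D_{S_3}\tfrac{\tilde S_1}{2}=\tilde G_1D_{S_3}+G_2^*D_{S_3}S_3.$$
   Context: For a contraction $T$, $D_T=(I-T^*T)^{1/2}$ and $\mathcal{D}_T$ is the closure of its range. Let $E=\{\operatorname{diag}(z_1,z_2,z_2):z_1,z_2\in\mathbb{C}\}\subset M_3(\mathbb{C})$ and, for $A\in M_3(\mathbb{C})$, $\mu_E(A)=1/\inf\{\|X\|: X\in E,\ \det(I-AX)=0\}$ (operator norm), with $\mu_E(A)=0$ if $I-AX$ is nonsingular for all $X\in E$. $\Gamma_{E(3;2;1,2)}$ is the set of all $(x_1,x_2,x_3,y_1,y_2)\in\mathbb{C}^5$ with $x_1=a_{11}$, $x_2=(a_{11}a_{22}-a_{12}a_{21})+(a_{11}a_{33}-a_{13}a_{31})$, $x_3=\det A$, $y_1=a_{22}+a_{33}$, $y_2=a_{22}a_{33}-a_{23}a_{32}$ for some $A=(a_{ij})\in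 M_3(\mathbb{C})$ with $\mu_{E}(A)\le1$. A commuting $5$-tuple $\mathbf{S}=(S_1,S_2,S_3,\tilde S_1,\tilde S_2)$ of bounded operators is a $\Gamma_{E(3;2;1,2)}$-contraction if this set is a spectral set for $\mathbf{S}$: its Taylor joint spectrum lies in the set and $\|f(\mathbf{S})\|\le\sup_{\Gamma_{E(3;2;1,2)}}|f|$ for every $f$ holomorphic on a neighbourhood of the set. In this statement the fundamental operators of $\mathbf{S}$ are the unique solutions $G_1,\tilde G_2,G_2,\tilde G_1\in\mathcal{B}(\mathcal{D}_{S_3})$ of $S_1-\tilde S_2^*S_3=D_{S_3}G_1D_{S_3}$, $\tilde S_2-S_1^*S_3=D_{S_3}\tilde G_2D_{S_3}$, $\frac{S_2}{2}-\frac{\tilde S_1^*}{2}S_3=D_{S_3}G_2D_{S_3}$, $\frac{\tilde S_1}{2}-\frac{S_2^*}{2}S_3=D_{S_3}\tilde G_1D_{S_3}$. *)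

theory Defs
  imports "HOL-Analysis.Analysis"
begin

section \<open>Complex Hilbert spaces and bounded operators\<close>

text \<open>The inner product is linear in its first argument. Positive definiteness is inherited
  from the norm through \<open>cinner_self\<close>.\<close>

class complex_hilbert = banach +
  fixes scaleC :: "complex \<Rightarrow> 'a \<Rightarrow> 'a"
    and cinner :: "'a \<Rightarrow> 'a \<Rightarrow> complex"
  assumes scaleC_add_right: "scaleC c (x + y) = scaleC c x + scaleC c y"
    and scaleC_add_left: "scaleC (c + d) x = scaleC c x + scaleC d x"
    and scaleC_scaleC: "scaleC c (scaleC d x) = scaleC (c * d) x"
    and scaleC_of_real: "scaleC (complex_of_real r) x = r *\<^sub>R x"
    and cinner_commute: "cinner x y = cnj (cinner y x)"
    and cinner_add_left: "cinner (x + y) z = cinner x z + cinner y z"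
    and cinner_scaleC_left: "cinner (scaleC c x) y = c * cinner x y"
    and cinner_self: "cinner x x = complex_of_real ((norm x)\<^sup>2)"

text \<open>Operators on a closed subspace \<open>M\<close> are functions that are \<open>undefined\<close> outside \<open>M\<close>, so
  that two operators on \<open>M\<close> are equal iff they agree on \<open>M\<close>. For \<open>M = UNIV\<close> these are the
  bounded operators on the whole space.\<close>

definition bounded_ops :: "'a::complex_hilbert set \<Rightarrow> ('a \<Rightarrow> 'a) set" where
  "bounded_ops M = {G \<in> M \<rightarrow>\<^sub>E M.
     (\<forall>x\<in>M. \<forall>y\<in>M. G (x + y) = G x + G y) \<and>
     (\<forall>c. \<forall>x\<in>M. G (scaleC c x) = scaleC c (G x)) \<and>
     (\<exists>K. \<forall>x\<in>M. norm (G x) \<le> K * norm x)}"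

definition adj_on :: "'a::complex_hilbert set \<Rightarrow> ('a \<Rightarrow> 'a) \<Rightarrow> 'a \<Rightarrow> 'a" where
  "adj_on M G = (\<lambda>y\<in>M. THE w. w \<in> M \<and> (\<forall>x\<in>M. cinner (G x) y = cinner x w))"

abbreviation adj :: "('a::complex_hilbert \<Rightarrow> 'a) \<Rightarrow> 'a \<Rightarrow> 'a" where
  "adj \<equiv> adj_on UNIV"

definition positive_op :: "('a::complex_hilbert \<Rightarrow> 'a) \<Rightarrow> bool" where
  "positive_op A \<longleftrightarrow> A \<in> bounded_ops UNIV \<and> (\<forall>x. cinner (A x) x \<in> \<real>\<^sub>\<ge>\<^sub>0)"

definition sqrt_op :: "('a::complex_hilbert \<Rightarrow> 'a) \<Rightarrow> 'a \<Rightarrow> 'a" where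
  "sqrt_op A = (THE B. positive_op B \<and> B \<circ> B = A)"

definition defect_op :: "('a::complex_hilbert \<Rightarrow> 'a) \<Rightarrow> 'a \<Rightarrow> 'a" where
  "defect_op T = sqrt_op (\<lambda>x. x - adj T (T x))"

definition defect_space :: "('a::complex_hilbert \<Rightarrow> 'a) \<Rightarrow> 'a set" where
  "defect_space T = closure (range (defect_op T))"


section \<open>Taylor joint spectrum\<close>

text \<open>The Koszul complex of a commuting tuple \<open>(T\<^sub>i)\<close>, \<open>i \<in> I\<close>. A family \<open>\<xi>\<close> of vectors indexed by
  the subsets \<open>J\<close> of \<open>I\<close> stands for the element \<open>\<Sum>\<^sub>J \<xi> J \<otimes> e\<^sub>J\<close> of the exterior algebra over the
  Hilbert space; the boundary map is \<open>\<xi> \<mapsto> \<Sum>\<^sub>i e\<^sub>i \<and> T\<^sub>i \<xi>\<close>. Since the map is homogeneous of degree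
  one, exactness of the total complex is exactness in every degree.\<close>

definition koszul :: "('i::linorder \<Rightarrow> 'a \<Rightarrow> 'a) \<Rightarrow> ('i set \<Rightarrow> 'a::complex_hilbert) \<Rightarrow> 'i set \<Rightarrow> 'a" where
  "koszul T \<xi> J = (\<Sum>j\<in>J. (- 1) ^ card {i \<in> J. i < j} *\<^sub>R T j (\<xi> (J - {j})))"

definition koszul_exact :: "'i::linorder set \<Rightarrow> ('i \<Rightarrow> 'a::complex_hilbert \<Rightarrow> 'a) \<Rightarrow> bool" where
  "koszul_exact I T \<longleftrightarrow>
     (\<forall>\<xi>. (\<forall>J\<subseteq>I. koszul T \<xi> J = 0) \<longrightarrow> (\<exists>\<eta>. \<forall>J\<subseteq>I. \<xi> J = koszul T \<eta> J))"

definition taylor_spectrum_on ::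
    "'i::linorder set \<Rightarrow> ('i \<Rightarrow> 'a::complex_hilbert \<Rightarrow> 'a) \<Rightarrow> ('i \<Rightarrow> complex) set" where
  "taylor_spectrum_on I T =
     {z \<in> extensional I. \<not> koszul_exact I (\<lambda>i x. T i x - scaleC (z i) x)}"

definition taylor_spectrum ::
    "('n::{finite,linorder} \<Rightarrow> 'a::complex_hilbert \<Rightarrow> 'a) \<Rightarrow> (complex, 'n) vec set" where
  "taylor_spectrum T = {z. vec_nth z \<in> taylor_spectrum_on UNIV T}"


section \<open>Taylor functional calculus and spectral sets\<close>

definition holomorphic_several :: "(complex^'n \<Rightarrow> complex) \<Rightarrow> (complex^'n) set \<Rightarrow> bool" where
  "holomorphic_several f U \<longleftrightarrow>
     (\<forall>z\<in>U. \<exists>f'. (f has_derivative f') (at z) \<and> (\<forall>c v. f' (c *s v) = c * f' v))"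

definition holomorphic_near :: "(complex^'n \<Rightarrow> complex) \<Rightarrow> (complex^'n) set \<Rightarrow> bool" where
  "holomorphic_near f K \<longleftrightarrow> (\<exists>U. open U \<and> K \<subseteq> U \<and> holomorphic_several f U)"

text \<open>Taylor's calculus \<open>f \<mapsto> f(T)\<close> for functions \<open>f\<close> holomorphic near the joint spectrum of \<open>T\<close>,
  given by its characteristic properties (existence: Taylor; uniqueness: Putinar, Uniqueness of
  Taylor's functional calculus, 1983): it is a continuous unital homomorphism that maps the
  coordinates to the \<open>T\<^sub>i\<close> and satisfies the spectral mapping theorem for all finite tuples of
  functions. That \<open>\<Phi> f\<close> depends only on the germ of \<open>f\<close> is the continuity clause for constant
  sequences. Values of \<open>\<Phi>\<close> at other functions are irrelevant.\<close>

definition taylor_calculus ::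
    "('n::{finite,linorder} \<Rightarrow> 'a::complex_hilbert \<Rightarrow> 'a)
      \<Rightarrow> (((complex, 'n) vec \<Rightarrow> complex) \<Rightarrow> 'a \<Rightarrow> 'a) \<Rightarrow> bool" where
  "taylor_calculus T \<Phi> \<longleftrightarrow>
     (\<forall>f. holomorphic_near f (taylor_spectrum T) \<longrightarrow> \<Phi> f \<in> bounded_ops UNIV) \<and>
     (\<forall>f g. holomorphic_near f (taylor_spectrum T) \<longrightarrow> holomorphic_near g (taylor_spectrum T) \<longrightarrow>
        \<Phi> (\<lambda>z. f z + g z) = (\<lambda>x. \<Phi> f x + \<Phi> g x) \<and>
        \<Phi> (\<lambda>z. f z * g z) = \<Phi> f \<circ> \<Phi> g) \<and>
     (\<forall>c. \<Phi> (\<lambda>z. c) = scaleC c) \<and>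
     (\<forall>i. \<Phi> (\<lambda>z. z $ i) = T i) \<and>
     (\<forall>U f F. open U \<longrightarrow> taylor_spectrum T \<subseteq> U \<longrightarrow>
        holomorphic_several f U \<longrightarrow> (\<forall>k::nat. holomorphic_several (F k) U) \<longrightarrow>
        (\<forall>C. compact C \<longrightarrow> C \<subseteq> U \<longrightarrow> uniform_limit C F f sequentially) \<longrightarrow>
        (\<lambda>k. onorm (\<lambda>x. \<Phi> (F k) x - \<Phi> f x)) \<longlonglongrightarrow> 0) \<and>
     (\<forall>(m::nat) F. (\<forall>j<m. holomorphic_near (F j) (taylor_spectrum T)) \<longrightarrow>
        taylor_spectrum_on {..<m} (\<lambda>j. \<Phi> (F j)) =
          (\<lambda>z. \<lambda>j\<in>{..<m}. F j z) ` taylor_spectrum T)"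

text \<open>The supremum is taken in the extended reals.\<close>

definition spectral_set ::
    "(complex, 'n) vec set \<Rightarrow> ('n::{finite,linorder} \<Rightarrow> 'a::complex_hilbert \<Rightarrow> 'a) \<Rightarrow> bool" where
  "spectral_set K T \<longleftrightarrow> taylor_spectrum T \<subseteq> K \<and>
     (\<exists>\<Phi>. taylor_calculus T \<Phi> \<and>
        (\<forall>f. holomorphic_near f K \<longrightarrow> ereal (onorm (\<Phi> f)) \<le> (SUP z\<in>K. ereal (cmod (f z)))))"


section \<open>The domain and its contractions\<close>

definition E_space :: "(complex^3^3) set" where
  "E_space = {X. \<exists>z1 z2. X = (\<chi> i j. if i = j then (if i = 1 then z1 else z2) else 0)}"

definition mu_E :: "complex^3^3 \<Rightarrow> real" where
  "mu_E A = (if \<forall>X\<in>E_space. det (mat 1 - A ** X) \<noteq> 0 then 0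
     else 1 / Inf {onorm (\<lambda>v. X *v v) | X. X \<in> E_space \<and> det (mat 1 - A ** X) = 0})"

text \<open>The coordinates 1 to 5 are \<open>x\<^sub>1, x\<^sub>2, x\<^sub>3, y\<^sub>1, y\<^sub>2\<close>.\<close>

definition Gamma_E :: "(complex^5) set" where
  "Gamma_E = {p. \<exists>A :: complex^3^3. mu_E A \<le> 1 \<and>
     p$1 = A$1$1 \<and>
     p$2 = (A$1$1 * A$2$2 - A$1$2 * A$2$1) + (A$1$1 * A$3$3 - A$1$3 * A$3$1) \<and>
     p$3 = det A \<and>
     p$4 = A$2$2 + A$3$3 \<and>
     p$5 = A$2$2 * A$3$3 - A$2$3 * A$3$2}"

definition tuple5 :: "'b \<Rightarrow> 'b \<Rightarrow> 'b \<Rightarrow> 'b \<Rightarrow> 'b \<Rightarrow> 5 \<Rightarrow> 'b" where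
  "tuple5 a1 a2 a3 a4 a5 i =
     (if i = 1 then a1 else if i = 2 then a2 else if i = 3 then a3 else if i = 4 then a4 else a5)"

text \<open>In the names below \<open>St1, St2, Gt1, Gt2\<close> stand for the operators written with a tilde.\<close>

definition Gamma_E_contraction ::
    "('a::complex_hilbert \<Rightarrow> 'a) \<Rightarrow> ('a \<Rightarrow> 'a) \<Rightarrow> ('a \<Rightarrow> 'a) \<Rightarrow> ('a \<Rightarrow> 'a) \<Rightarrow> ('a \<Rightarrow> 'a) \<Rightarrow> bool" where
  "Gamma_E_contraction S1 S2 S3 St1 St2 \<longleftrightarrow>
     (let S = tuple5 S1 S2 S3 St1 St2 in
       (\<forall>i. S i \<in> bounded_ops UNIV) \<and>
       (\<forall>i j. S i \<circ> S j = S j \<circ> S i) \<and>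
       spectral_set Gamma_E S)"

definition fundamental_eqs ::
    "('a::complex_hilbert \<Rightarrow> 'a) \<Rightarrow> ('a \<Rightarrow> 'a) \<Rightarrow> ('a \<Rightarrow> 'a) \<Rightarrow> ('a \<Rightarrow> 'a) \<Rightarrow> ('a \<Rightarrow> 'a)
      \<Rightarrow> ('a \<Rightarrow> 'a) \<Rightarrow> ('a \<Rightarrow> 'a) \<Rightarrow> ('a \<Rightarrow> 'a) \<Rightarrow> ('a \<Rightarrow> 'a) \<Rightarrow> bool" where
  "fundamental_eqs S1 S2 S3 St1 St2 G1 Gt2 G2 Gt1 \<longleftrightarrow>
     (let D = defect_op S3 in \<forall>x.
       S1 x - adj St2 (S3 x) = D (G1 (D x)) \<and>
       St2 x - adj S1 (S3 x) = D (Gt2 (D x)) \<and>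
       scaleC (1/2) (S2 x) - scaleC (1/2) (adj St1 (S3 x)) = D (G2 (D x)) \<and>
       scaleC (1/2) (St1 x) - scaleC (1/2) (adj S2 (S3 x)) = D (Gt1 (D x)))"

definition fundamental_operators ::
    "('a::complex_hilbert \<Rightarrow> 'a) \<Rightarrow> ('a \<Rightarrow> 'a) \<Rightarrow> ('a \<Rightarrow> 'a) \<Rightarrow> ('a \<Rightarrow> 'a) \<Rightarrow> ('a \<Rightarrow> 'a)
      \<Rightarrow> ('a \<Rightarrow> 'a) \<Rightarrow> ('a \<Rightarrow> 'a) \<Rightarrow> ('a \<Rightarrow> 'a) \<Rightarrow> ('a \<Rightarrow> 'a) \<Rightarrow> bool" where
  "fundamental_operators S1 S2 S3 St1 St2 G1 Gt2 G2 Gt1 \<longleftrightarrow>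
     (\<forall>F1 Ft2 F2 Ft1.
        {F1, Ft2, F2, Ft1} \<subseteq> bounded_ops (defect_space S3) \<and>
        fundamental_eqs S1 S2 S3 St1 St2 F1 Ft2 F2 Ft1
        \<longleftrightarrow> F1 = G1 \<and> Ft2 = Gt2 \<and> F2 = G2 \<and> Ft1 = Gt1)"

end

theory Submission imports Defs begin

text \<open>The five operators split into two triples \<open>(S\<^sub>1, St\<^sub>2, S\<^sub>3)\<close> and \<open>(S\<^sub>2 / 2, St\<^sub>1 / 2, S\<^sub>3)\<close> that behave like
tetrablock contractions \<open>(A, B, P)\<close>, and the theorem is a statement about each triple separately.

If \<open>p\<close> is a point of the domain, then \<open>1 - z x\<^sub>1 - w (y\<^sub>1 - z x\<^sub>2) + w\<^sup>2 (y\<^sub>2 - z x\<^sub>3)\<close>, which is the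
determinant of \<open>1 - A X\<close> for \<open>X = diag (z, w, w)\<close>, has no zeros in the bidisc. As a quadratic in
\<open>w\<close> its leading coefficient is dominated by the constant one, so that \<open>(x\<^sub>1, y\<^sub>2, x\<^sub>3)\<close> lies in the
closed tetrablock (\<open>Gamma_E_tetrablock_outer\<close>). Polarizing in \<open>w\<close> and then identifying \<open>z\<close> with one
of the two new variables shows the same of \<open>(x\<^sub>2 / 2, y\<^sub>1 / 2, x\<^sub>3)\<close> (\<open>Gamma_E_tetrablock_inner\<close>).
On the tetrablock the functions \<open>(b - z p) / (1 - z a)\<close> and \<open>(a - z p) / (1 - z b)\<close> are bounded by
\<open>1\<close>. The spectral set condition turns this into \<open>\<parallel>B x - z P x\<parallel> \<le> \<parallel>x - z A x\<parallel>\<close> and the inequality with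
\<open>A\<close> and \<open>B\<close> exchanged (\<open>spectral_set_contractive_pair\<close>).

Squaring both inequalities on the unit circle and adding them bounds the quadratic forms of
\<open>A - B\<^sup>* P\<close> and \<open>B - A\<^sup>* P\<close> by \<open>\<parallel>D x\<parallel>\<^sup>2 = \<parallel>x\<parallel>\<^sup>2 - \<parallel>P x\<parallel>\<^sup>2\<close>, where \<open>D\<close> is the defect operator of \<open>P\<close>
(\<open>numerical_radius_bound\<close>). An operator dominated by \<open>D\<close> in this way factors as \<open>D G D\<close>
(\<open>factor_through_closure_range\<close>), which yields the fundamental operators. They are unique because
\<open>D\<close> has dense range in the defect space.

The fundamental equations and the system \<open>D A = F D + H\<^sup>* D P\<close>, \<open>D B = H D + F\<^sup>* D P\<close> are equivalent
(\<open>equations_iff\<close>). If the former hold, multiplying the system by \<open>D\<close> reduces it to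
\<open>A - P\<^sup>* P A = (A - B\<^sup>* P) + (B - A\<^sup>* P)\<^sup>* P\<close>, an identity for commuting operators. Conversely, the
difference \<open>X\<close> between \<open>D F D\<close> and \<open>A - B\<^sup>* P\<close> satisfies \<open>X = P\<^sup>* X P\<close> and is dominated by \<open>D\<close>; since
\<open>D P\<^sup>n x\<close> tends to \<open>0\<close>, it vanishes.

The inner product geometry, adjoints and positive square roots on which \<open>D\<close> rests are developed from
the class axioms.\<close>

section \<open>Complex inner products\<close>

abbreviation bounded_op :: "('a::complex_hilbert \<Rightarrow> 'a) \<Rightarrow> bool" where
  "bounded_op L \<equiv> L \<in> bounded_ops UNIV"

lemma cinner_add_right: "cinner x (y + z) = cinner x y + cinner x z"
  by (metis cinner_add_left cinner_commute complex_cnj_add)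

lemma cinner_scaleC_right: "cinner x (scaleC c y) = cnj c * cinner x y"
  by (metis cinner_commute cinner_scaleC_left complex_cnj_mult)

lemma scaleC_one [simp]: "scaleC 1 x = x"
  using scaleC_of_real[of 1 x] by simp

lemma scaleC_minus_one: "scaleC (- 1) x = - x"
  using scaleC_of_real[of "-1" x] by simp

lemma scaleC_minus_left: "scaleC (- c) x = - scaleC c x"
  using scaleC_scaleC[of "- 1" c x] by (simp add: scaleC_minus_one)

lemma scaleR_scaleC: "r *\<^sub>R x = scaleC (complex_of_real r) x"
  by (simp add: scaleC_of_real)

lemma scaleC_zero_right [simp]: "scaleC c 0 = 0"
  using scaleC_add_right[of c 0 0] by simp

lemma scaleC_minus_right: "scaleC c (- x) = - scaleC c x"
  using scaleC_add_right[of c x "- x"] by (simp add: eq_neg_iff_add_eq_0 add.commute)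

lemma scaleC_diff_right: "scaleC c (x - y) = scaleC c x - scaleC c y"
  using scaleC_add_right[of c x "- y"] by (simp add: scaleC_minus_right)

lemma cinner_zero_left [simp]: "cinner 0 x = 0"
  using cinner_add_left[of 0 0 x] by simp

lemma cinner_zero_right [simp]: "cinner x 0 = 0"
  using cinner_add_right[of x 0 0] by simp

lemma cinner_minus_left: "cinner (- x) y = - cinner x y"
  using cinner_scaleC_left[of "-1" x y] by (simp add: scaleC_minus_one)

lemma cinner_minus_right: "cinner x (- y) = - cinner x y"
  using cinner_scaleC_right[of x "-1" y] by (simp add: scaleC_minus_one)

lemma cinner_diff_left: "cinner (x - y) z = cinner x z - cinner y z"
  using cinner_add_left[of x "- y" z] by (simp add: cinner_minus_left)

lemma cinner_diff_right: "cinner x (y - z) = cinner x y - cinner x z"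
  using cinner_add_right[of x y "- z"] by (simp add: cinner_minus_right)

lemmas cinner_simps =
  cinner_add_left cinner_add_right cinner_diff_left cinner_diff_right
  cinner_scaleC_left cinner_scaleC_right cinner_minus_left cinner_minus_right

lemma cinner_self_eq_0_iff: "cinner x x = 0 \<longleftrightarrow> x = 0"
  by (simp add: cinner_self)

lemma Re_cinner_commute: "Re (cinner y x) = Re (cinner x y)"
  by (metis cinner_commute complex_cnj(1) cnj.simps(1))

lemma power2_norm_eq_Re_cinner: "(norm x)\<^sup>2 = Re (cinner x x)"
  by (simp add: cinner_self)

lemma norm_add_sq: "(norm (x + y))\<^sup>2 = (norm x)\<^sup>2 + (norm y)\<^sup>2 + 2 * Re (cinner x y)"
  unfolding power2_norm_eq_Re_cinner by (simp add: cinner_simps Re_cinner_commute)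

lemma norm_diff_sq: "(norm (x - y))\<^sup>2 = (norm x)\<^sup>2 + (norm y)\<^sup>2 - 2 * Re (cinner x y)"
  unfolding power2_norm_eq_Re_cinner by (simp add: cinner_simps Re_cinner_commute)

lemma norm_scaleC: "norm (scaleC c x) = cmod c * norm x"
proof -
  have "cinner (scaleC c x) (scaleC c x) = (c * cnj c) * cinner x x"
    by (simp only: cinner_scaleC_left cinner_scaleC_right ac_simps)
  also have "c * cnj c = complex_of_real ((cmod c)\<^sup>2)" by (rule complex_norm_square[symmetric])
  finally have "complex_of_real ((norm (scaleC c x))\<^sup>2)
      = complex_of_real ((cmod c)\<^sup>2 * (norm x)\<^sup>2)"
    by (simp only: cinner_self of_real_mult)
  then have "(norm (scaleC c x))\<^sup>2 = (cmod c * norm x)\<^sup>2"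
    by (simp only: of_real_eq_iff power_mult_distrib)
  then show ?thesis by (simp add: power2_eq_iff_nonneg)
qed

lemma cinner_Cauchy_Schwarz: "cmod (cinner x y) \<le> norm x * norm y"
proof (cases "y = 0")
  case False
  define c where "c = cinner x y"
  define n where "n = (norm y)\<^sup>2"
  have n: "n > 0" using False by (simp add: n_def)
  have "0 \<le> (norm (scaleC (of_real n) x - scaleC c y))\<^sup>2" by simp
  also have "\<dots> = (n * norm x)\<^sup>2 + (cmod c * norm y)\<^sup>2
      - 2 * Re (cinner (scaleC (of_real n) x) (scaleC c y))"
    using n by (simp add: norm_diff_sq norm_scaleC)
  also have "cinner (scaleC (of_real n) x) (scaleC c y) = of_real n * (c * cnj c)"
    by (simp add: cinner_simps c_def)
  also have "c * cnj c = of_real ((cmod c)\<^sup>2)" by (rule complex_norm_square[symmetric])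
  also have "(n * norm x)\<^sup>2 + (cmod c * norm y)\<^sup>2 - 2 * Re (of_real n * of_real ((cmod c)\<^sup>2))
      = n * (n * (norm x)\<^sup>2 - (cmod c)\<^sup>2)"
    by (simp add: power_mult_distrib algebra_simps power2_eq_square n_def)
  finally have "(cmod c)\<^sup>2 \<le> n * (norm x)\<^sup>2"
    using n by (simp add: zero_le_mult_iff)
  then have "(cmod c)\<^sup>2 \<le> (norm x * norm y)\<^sup>2"
    by (simp add: n_def power_mult_distrib mult.commute)
  then show ?thesis unfolding c_def by (rule power2_le_imp_le) simp
qed simp

lemma bounded_bilinear_cinner: "bounded_bilinear (cinner :: 'a::complex_hilbert \<Rightarrow> _)"
proof (unfold_locales)
  show "\<exists>K. \<forall>a b. norm (cinner (a::'a) b) \<le> norm a * norm b * K"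
    by (rule exI[of _ 1]) (simp add: cinner_Cauchy_Schwarz)
qed (simp_all add: cinner_simps scaleR_scaleC scaleR_conv_of_real)

lemma bounded_bilinear_scaleC: "bounded_bilinear (scaleC :: complex \<Rightarrow> 'a::complex_hilbert \<Rightarrow> _)"
proof (unfold_locales)
  show "\<exists>K. \<forall>a b. norm (scaleC a (b::'a)) \<le> norm a * norm b * K"
    by (rule exI[of _ 1]) (simp add: norm_scaleC)
qed (simp_all add: scaleC_add_left scaleC_add_right scaleR_scaleC scaleC_scaleC
    scaleR_conv_of_real mult.commute)

lemmas tendsto_cinner = bounded_bilinear.tendsto[OF bounded_bilinear_cinner]
lemmas continuous_on_cinner = bounded_bilinear.continuous_on[OF bounded_bilinear_cinner]
lemmas continuous_on_scaleC = bounded_bilinear.continuous_on[OF bounded_bilinear_scaleC]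

section \<open>Bounded operators\<close>

lemma bounded_op_add: "bounded_op L \<Longrightarrow> L (x + y) = L x + L y"
  and bounded_op_scaleC: "bounded_op L \<Longrightarrow> L (scaleC c x) = scaleC c (L x)"
  by (auto simp: bounded_ops_def)

lemma bounded_op_bound: "bounded_op L \<Longrightarrow> \<exists>K. \<forall>x. norm (L x) \<le> K * norm x"
  by (auto simp: bounded_ops_def)

lemma bounded_opI:
  assumes "\<And>x y. L (x + y) = L x + L y" "\<And>c x. L (scaleC c x) = scaleC c (L x)"
    "\<And>x. norm (L x) \<le> K * norm x"
  shows "bounded_op L"
  using assms by (auto simp: bounded_ops_def)

lemma bounded_op_bounded_linear:
  assumes "bounded_op L" shows "bounded_linear L"
proof -
  obtain K where K: "\<And>x. norm (L x) \<le> K * norm x" using bounded_op_bound[OF assms] by blast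
  show ?thesis
    by (rule bounded_linear_intro[where K = K])
      (use K in \<open>auto simp: bounded_op_add[OF assms] scaleR_scaleC bounded_op_scaleC[OF assms]
        mult.commute\<close>)
qed

lemma bounded_op_diff: "bounded_op L \<Longrightarrow> L (x - y) = L x - L y"
  and bounded_op_zero: "bounded_op L \<Longrightarrow> L 0 = 0"
  by (simp_all add: linear_diff linear_0 bounded_linear.linear bounded_op_bounded_linear)

lemma bounded_op_tendsto: "bounded_op L \<Longrightarrow> (f \<longlongrightarrow> l) F \<Longrightarrow> ((\<lambda>x. L (f x)) \<longlongrightarrow> L l) F"
  by (rule bounded_linear.tendsto[OF bounded_op_bounded_linear])

lemma bounded_op_compose:
  assumes "bounded_op L" "bounded_op K" shows "bounded_op (\<lambda>x. L (K x))"
proof -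
  have "bounded_linear (\<lambda>x. L (K x))"
    using assms bounded_linear_compose bounded_op_bounded_linear by blast
  then obtain C where "\<And>x. norm (L (K x)) \<le> norm x * C"
    using bounded_linear.bounded by blast
  then show ?thesis
    by (intro bounded_opI[where K = C]) (simp_all add: assms bounded_op_add bounded_op_scaleC mult.commute)
qed

lemma bounded_op_sub:
  assumes "bounded_op L" "bounded_op K" shows "bounded_op (\<lambda>x. L x - K x)"
proof -
  have "bounded_linear (\<lambda>x. L x - K x)"
    using assms bounded_linear_sub bounded_op_bounded_linear by blast
  then obtain C where "\<And>x. norm (L x - K x) \<le> norm x * C"
    using bounded_linear.bounded by blast
  then show ?thesis
    by (intro bounded_opI[where K = C])
      (simp_all add: assms bounded_op_add bounded_op_scaleC mult.commute scaleC_diff_right)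
qed

lemma bounded_op_scale:
  assumes "bounded_op L" shows "bounded_op (\<lambda>x. scaleC c (L x))"
proof -
  obtain K where K: "\<And>x. norm (L x) \<le> K * norm x" using bounded_op_bound[OF assms] by blast
  have "norm (scaleC c (L x)) \<le> (cmod c * K) * norm x" for x
    using mult_left_mono[OF K norm_ge_zero, of c] by (simp add: norm_scaleC mult.assoc)
  then show ?thesis
    by (intro bounded_opI[where K = "cmod c * K"])
      (simp_all add: assms bounded_op_add bounded_op_scaleC scaleC_add_right scaleC_scaleC mult.commute)
qed

lemma bounded_op_id: "bounded_op (\<lambda>x. x)"
  by (rule bounded_opI[where K = 1]) simp_all

section \<open>Riesz representation through an operator\<close>

text \<open>Riesz' theorem is needed for the whole space and for the defect space, and in the latter case for
functionals that are known only on the range of the defect operator, which need not be closed. All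
cases have the form \<open>\<phi> k = \<langle>L k, w\<rangle>\<close> with \<open>w\<close> in the closure of the range of an operator \<open>L\<close>, and
the auxiliary lemmas treat closures of ranges.\<close>

lemma closure_range_add:
  fixes L :: "'a::complex_hilbert \<Rightarrow> 'a"
  assumes L: "bounded_op L" and "x \<in> closure (range L)" "y \<in> closure (range L)"
  shows "x + y \<in> closure (range L)"
proof -
  from assms(2,3) obtain f g
    where f: "\<forall>n. f n \<in> range L" "f \<longlonglongrightarrow> x" and g: "\<forall>n. g n \<in> range L" "g \<longlonglongrightarrow> y"
    unfolding closure_sequential by blast
  have "f n + g n \<in> range L" for n
    using f(1) g(1) bounded_op_add[OF L] by (metis rangeE rangeI)
  moreover have "(\<lambda>n. f n + g n) \<longlonglongrightarrow> x + y" by (intro tendsto_intros f g)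
  ultimately show ?thesis unfolding closure_sequential
    by (intro exI[of _ "\<lambda>n. f n + g n"]) simp
qed

lemma closure_range_scaleC:
  fixes L :: "'a::complex_hilbert \<Rightarrow> 'a"
  assumes L: "bounded_op L" and "x \<in> closure (range L)"
  shows "scaleC c x \<in> closure (range L)"
proof -
  from assms(2) obtain f where f: "\<forall>n. f n \<in> range L" "f \<longlonglongrightarrow> x"
    unfolding closure_sequential by blast
  have "scaleC c (f n) \<in> range L" for n
    using f(1) bounded_op_scaleC[OF L] by (metis rangeE rangeI)
  moreover have "(\<lambda>n. scaleC c (f n)) \<longlonglongrightarrow> scaleC c x"
    by (intro bounded_bilinear.tendsto[OF bounded_bilinear_scaleC] tendsto_const f)
  ultimately show ?thesis unfolding closure_sequential
    by (intro exI[of _ "\<lambda>n. scaleC c (f n)"]) simp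
qed

lemma closure_range_diff:
  assumes "bounded_op L" "x \<in> closure (range L)" "y \<in> closure (range L)"
  shows "x - y \<in> closure (range L)"
  using closure_range_add[OF assms(1,2) closure_range_scaleC[OF assms(1,3), of "- 1"]]
  by (simp add: scaleC_minus_one)

lemma orthogonal_closure_range:
  assumes "\<And>k. cinner (L k) w = 0" "x \<in> closure (range L)"
  shows "cinner x w = 0"
proof -
  have "closed {x. cinner x w = 0}"
    by (intro closed_Collect_eq continuous_on_cinner continuous_intros)
  then have "closure (range L) \<subseteq> {x. cinner x w = 0}"
    by (intro closure_minimal) (use assms(1) in auto)
  then show ?thesis using assms(2) by blast
qed

lemma eq_on_closure_range:
  assumes L: "bounded_op L" and "v \<in> closure (range L)" "w \<in> closure (range L)"
    and "\<And>k. cinner (L k) v = cinner (L k) w"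
  shows "v = w"
proof -
  have "cinner (v - w) (v - w) = 0"
    by (rule orthogonal_closure_range[where L = L])
      (use assms in \<open>auto simp: cinner_diff_right intro: closure_range_diff\<close>)
  then show ?thesis by (simp add: cinner_self_eq_0_iff)
qed

text \<open>The first-order condition of a variational argument.\<close>

lemma linear_coeff_zero:
  fixes a b :: real
  assumes "\<And>t. 0 \<le> t\<^sup>2 * a + t * b" shows "b = 0"
proof (rule ccontr)
  assume b: "b \<noteq> 0"
  define n where "n = \<bar>a\<bar> + 1"
  have n: "n > 0" "a < n" by (auto simp: n_def)
  have "(- b / n)\<^sup>2 * a + (- b / n) * b = (b\<^sup>2 / n\<^sup>2) * (a - n)"
    using n by (simp add: field_simps power2_eq_square)
  also have "\<dots> < 0" using b n by (intro mult_pos_neg) auto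
  finally show False using assms[of "- b / n"] by linarith
qed

text \<open>The bound makes \<open>\<phi>\<close> a functional of \<open>L k\<close>. The functional \<open>J k = \<parallel>L k\<parallel>\<^sup>2 - 2 Re (\<phi> k)\<close> is bounded
below, and the parallelogram law turns a minimizing sequence into a Cauchy sequence of vectors
\<open>L (k n)\<close>. Its limit \<open>w\<close> represents \<open>\<phi>\<close>: the real parts agree because \<open>J\<close> cannot decrease to
first order, and the imaginary parts follow by replacing \<open>k\<close> by \<open>\<i> k\<close>. Infima along the sequence
replace a minimizer, which need not lie in the range.\<close>

lemma riesz_factor:
  fixes L :: "'a::complex_hilbert \<Rightarrow> 'a" and \<phi> :: "'a \<Rightarrow> complex"
  assumes L: "bounded_op L"
    and add: "\<And>h k. \<phi> (h + k) = \<phi> h + \<phi> k" and scale: "\<And>c k. \<phi> (scaleC c k) = c * \<phi> k"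
    and bd: "\<And>k. cmod (\<phi> k) \<le> C * norm (L k)" and C: "C \<ge> 0"
  shows "\<exists>w\<in>closure (range L). (\<forall>k. \<phi> k = cinner (L k) w) \<and> norm w \<le> C"
proof -
  define J where "J k = (norm (L k))\<^sup>2 - 2 * Re (\<phi> k)" for k
  have lower: "J k \<ge> - C\<^sup>2" for k
  proof -
    have "Re (\<phi> k) \<le> C * norm (L k)" using bd[of k] complex_Re_le_cmod[of "\<phi> k"] by linarith
    moreover have "0 \<le> (norm (L k) - C)\<^sup>2" by simp
    ultimately show ?thesis by (simp add: J_def power2_diff algebra_simps)
  qed
  define d where "d = (INF k. J k)"
  have bdd: "bdd_below (range J)" using lower by (intro bdd_belowI[of _ "- C\<^sup>2"]) auto
  have dle: "d \<le> J k" for k unfolding d_def by (rule cINF_lower[OF bdd]) simp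
  have "\<exists>k. J k < d + 1 / real (Suc n)" for n
    using cINF_less_iff[OF _ bdd, of "d + 1 / real (Suc n)"] by (auto simp: d_def)
  then obtain k where k: "\<And>n. J (k n) < d + 1 / real (Suc n)" by metis
  \<comment> \<open>the parallelogram law compares \<open>a\<close> and \<open>b\<close> with their midpoint\<close>
  have par: "(norm (L a - L b))\<^sup>2 \<le> 2 * (J a - d) + 2 * (J b - d)" for a b
  proof -
    define m where "m = scaleC (1/2) (a + b)"
    have Lm: "L m = scaleC (1/2) (L a + L b)"
      by (simp add: m_def bounded_op_scaleC[OF L] bounded_op_add[OF L])
    have "4 * J m = (norm (L a + L b))\<^sup>2 - 4 * Re (\<phi> a + \<phi> b)"
      unfolding J_def Lm by (simp add: norm_scaleC scale add m_def power_mult_distrib power_divide, simp add: field_simps)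
    then have "(norm (L a - L b))\<^sup>2 = 2 * J a + 2 * J b - 4 * J m"
      by (simp add: J_def norm_add_sq norm_diff_sq)
    then show ?thesis using dle[of m] by (simp add: algebra_simps)
  qed
  have "Cauchy (\<lambda>n. L (k n))"
  proof (rule metric_CauchyI)
    fix e :: real assume e: "e > 0"
    obtain N where N: "4 / e\<^sup>2 < real N" using reals_Archimedean2 by blast
    have "dist (L (k m)) (L (k n)) < e" if "m \<ge> N" "n \<ge> N" for m n
    proof -
      have "0 < real N" by (rule less_trans[OF _ N]) (use e in simp)
      then have N0: "N > 0" by simp
      have small: "1 / real (Suc j) \<le> 1 / real N" if "j \<ge> N" for j
        using that N0 by (simp add: frac_le)
      then have "(norm (L (k m) - L (k n)))\<^sup>2 < 4 / real N"
        using par[of "k m" "k n"] k[of m] k[of n] small[OF that(1)] small[OF that(2)] by simp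
      also have "\<dots> < e\<^sup>2" using N N0 e by (simp add: field_simps)
      finally show ?thesis using e by (simp add: dist_norm power2_less_imp_less)
    qed
    then show "\<exists>M. \<forall>m\<ge>M. \<forall>n\<ge>M. dist (L (k m)) (L (k n)) < e" by blast
  qed
  then obtain w where w: "(\<lambda>n. L (k n)) \<longlonglongrightarrow> w"
    using Cauchy_convergent_iff convergent_def by blast
  have wM: "w \<in> closure (range L)" 
    unfolding closure_sequential by (intro exI[of _ "\<lambda>n. L (k n)"]) (simp add: w)
  have Re_eq: "Re (\<phi> x) = Re (cinner (L x) w)" for x
  proof -
    have "0 \<le> t\<^sup>2 * (norm (L x))\<^sup>2 + t * (2 * (Re (cinner (L x) w) - Re (\<phi> x)))" for t :: real
    proof -
      define u where "u = scaleC (of_real t) x"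
      have Lu: "L u = scaleC (of_real t) (L x)" and pu: "\<phi> u = of_real t * \<phi> x"
        by (simp_all add: u_def bounded_op_scaleC[OF L] scale)
      have ineq: "- (1 / real (Suc n)) \<le> t\<^sup>2 * (norm (L x))\<^sup>2
          + t * (2 * (Re (cinner (L x) (L (k n))) - Re (\<phi> x)))" for n
      proof -
        have "J (u + k n) = (norm (L u))\<^sup>2 + (norm (L (k n)))\<^sup>2 + 2 * Re (cinner (L u) (L (k n)))
            - 2 * Re (\<phi> u) - 2 * Re (\<phi> (k n))"
          by (simp add: J_def bounded_op_add[OF L] norm_add_sq add)
        then have "J (u + k n) - J (k n) = t\<^sup>2 * (norm (L x))\<^sup>2
          + t * (2 * (Re (cinner (L x) (L (k n))) - Re (\<phi> x)))"
          by (simp add: J_def Lu pu norm_scaleC cinner_simps algebra_simps power_mult_distrib)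
        then show ?thesis using dle[of "u + k n"] k[of n] by linarith
      qed
      have "(\<lambda>n. - (1 / real (Suc n))) \<longlonglongrightarrow> - 0"
        by (intro tendsto_minus) (rule LIMSEQ_Suc[OF lim_1_over_n])
      moreover have "(\<lambda>n. t\<^sup>2 * (norm (L x))\<^sup>2
          + t * (2 * (Re (cinner (L x) (L (k n))) - Re (\<phi> x)))) \<longlonglongrightarrow> t\<^sup>2 * (norm (L x))\<^sup>2
          + t * (2 * (Re (cinner (L x) w) - Re (\<phi> x)))"
        by (intro tendsto_intros tendsto_cinner w)
      ultimately show ?thesis
        using LIMSEQ_le[of _ "- 0"] ineq by (auto intro: LIMSEQ_le)
    qed
    from linear_coeff_zero[OF this] show ?thesis by simp
  qed
  have eq: "\<phi> x = cinner (L x) w" for x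
  proof (rule complex_eqI)
    show "Re (\<phi> x) = Re (cinner (L x) w)" by (rule Re_eq)
    show "Im (\<phi> x) = Im (cinner (L x) w)"
      using Re_eq[of "scaleC \<i> x"] by (simp add: scale bounded_op_scaleC[OF L] cinner_simps)
  qed
  have "closed {x. cmod (cinner x w) \<le> C * norm x}"
    by (intro closed_Collect_le continuous_on_cinner continuous_intros)
  then have "closure (range L) \<subseteq> {x. cmod (cinner x w) \<le> C * norm x}"
    by (intro closure_minimal) (use bd eq in auto)
  then have "cmod (cinner w w) \<le> C * norm w" using wM by blast
  then have "norm w * norm w \<le> C * norm w"
    by (simp only: cinner_self norm_of_real) (simp add: power2_eq_square)
  then have "norm w \<le> C" using C by (cases "w = 0") (simp_all add: mult_le_cancel_right)
  with wM eq show ?thesis by blast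
qed

section \<open>Adjoints\<close>

lemma square_le_cancel:
  fixes a c :: real
  assumes "a * a \<le> c * a" "0 \<le> c" shows "a \<le> c"
proof (rule ccontr)
  assume "\<not> a \<le> c"
  then have "c * a < a * a" using assms(2) by (intro mult_strict_right_mono) auto
  then show False using assms(1) by simp
qed

text \<open>The adjoint of an operator on a subspace is defined by a description, so its existence has to be
supplied. Every subspace that occurs is \<open>closure (range L)\<close> for some \<open>L\<close> (the defect operator,
or the identity for the whole space), which makes the factored form of Riesz' theorem applicable.
The identity is obtained on the range first and carried to the closure by continuity.\<close>

lemma adj_on_closure_range:
  fixes L :: "'a::complex_hilbert \<Rightarrow> 'a"
  assumes L: "bounded_op L" and M: "M = closure (range L)" and G: "G \<in> bounded_ops M"
    and y: "y \<in> M"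
  shows "adj_on M G y \<in> M" and "\<And>x. x \<in> M \<Longrightarrow> cinner (G x) y = cinner x (adj_on M G y)"
proof -
  have "\<exists>K. \<forall>x\<in>M. norm (G x) \<le> K * norm x" using G by (simp add: bounded_ops_def)
  then obtain K where K: "\<And>x. x \<in> M \<Longrightarrow> norm (G x) \<le> K * norm x" by blast
  have G_add: "\<And>x y. x \<in> M \<Longrightarrow> y \<in> M \<Longrightarrow> G (x + y) = G x + G y"
    and G_scale: "\<And>c x. x \<in> M \<Longrightarrow> G (scaleC c x) = scaleC c (G x)"
    using G by (simp_all add: bounded_ops_def)
  have LM: "L k \<in> M" for k unfolding M by (rule subsetD[OF closure_subset]) simp
  have "\<exists>w\<in>closure (range L). (\<forall>k. cinner (G (L k)) y = cinner (L k) w) \<and> norm w \<le> \<bar>K\<bar> * norm y"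
  proof (rule riesz_factor[OF L])
    fix k
    have "cmod (cinner (G (L k)) y) \<le> norm (G (L k)) * norm y" by (rule cinner_Cauchy_Schwarz)
    also have "norm (G (L k)) * norm y \<le> (\<bar>K\<bar> * norm (L k)) * norm y"
      by (intro mult_right_mono order_trans[OF K[OF LM]]) simp_all
    finally show "cmod (cinner (G (L k)) y) \<le> \<bar>K\<bar> * norm y * norm (L k)"
      by (simp only: ac_simps)
  qed (simp_all add: bounded_op_add[OF L] bounded_op_scaleC[OF L] G_add G_scale LM cinner_add_left
      cinner_scaleC_left)
  then obtain w where w: "w \<in> M" "\<And>k. cinner (G (L k)) y = cinner (L k) w"
    unfolding M by auto
  have eq: "cinner (G x) y = cinner x w" if x: "x \<in> M" for x
  proof -
    from x have "\<exists>f. (\<forall>n. f n \<in> range L) \<and> f \<longlonglongrightarrow> x"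
      by (simp only: M closure_sequential)
    then obtain f where f: "\<forall>n. f n \<in> range L" "f \<longlonglongrightarrow> x" by auto
    have fM: "f n \<in> M" for n using f(1) LM by (metis rangeE)
    have "(\<lambda>n. norm (f n - x)) \<longlonglongrightarrow> 0" by (rule tendsto_norm_zero[OF LIM_zero[OF f(2)]])
    then have lim0: "(\<lambda>n. K * norm (f n - x)) \<longlonglongrightarrow> 0" by (rule tendsto_mult_right_zero)
    have le: "norm (G (f n) - G x) \<le> K * norm (f n - x)" for n
    proof -
      have d: "f n - x \<in> M" using closure_range_diff[OF L] fM[of n] x unfolding M by simp
      have "G (f n) = G (f n - x) + G x" using G_add[OF d x] by simp
      then show ?thesis using K[OF d] by simp
    qed
    have "(\<lambda>n. G (f n) - G x) \<longlonglongrightarrow> 0"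
      by (rule Lim_null_comparison[OF always_eventually[OF allI[OF le]] lim0])
    then have lim: "(\<lambda>n. G (f n)) \<longlonglongrightarrow> G x" by (rule LIM_zero_cancel)
    have "cinner (G (f n)) y = cinner (f n) w" for n using f(1) w(2) by (metis rangeE)
    then have "(\<lambda>n. cinner (f n) w) \<longlonglongrightarrow> cinner (G x) y"
      using tendsto_cinner[OF lim tendsto_const, of y] by simp
    moreover have "(\<lambda>n. cinner (f n) w) \<longlonglongrightarrow> cinner x w" by (intro tendsto_cinner f tendsto_const)
    ultimately show ?thesis by (rule LIMSEQ_unique)
  qed
  have "\<exists>!w. w \<in> M \<and> (\<forall>x\<in>M. cinner (G x) y = cinner x w)"
  proof (rule ex1I[of _ w])
    fix v assume v: "v \<in> M \<and> (\<forall>x\<in>M. cinner (G x) y = cinner x v)"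
    show "v = w"
    proof (rule eq_on_closure_range[OF L])
      show "cinner (L k) v = cinner (L k) w" for k using v eq[OF LM, of k] LM[of k] by simp
    qed (use v w M in auto)
  qed (use w eq in blast)
  note the = theI'[OF this]
  have eq: "adj_on M G y = (THE w. w \<in> M \<and> (\<forall>x\<in>M. cinner (G x) y = cinner x w))"
    unfolding adj_on_def using y by (rule restrict_apply')
  have "adj_on M G y \<in> M \<and> (\<forall>x\<in>M. cinner (G x) y = cinner x (adj_on M G y))"
    unfolding eq by (rule the)
  then show "adj_on M G y \<in> M"
    and "\<And>x. x \<in> M \<Longrightarrow> cinner (G x) y = cinner x (adj_on M G y)"
    by auto
qed

lemma cinner_adj: "bounded_op G \<Longrightarrow> cinner (G x) y = cinner x (adj G y)"
  using adj_on_closure_range(2)[OF bounded_op_id, of UNIV G y x] by simp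

lemma cinner_adj_left: "bounded_op G \<Longrightarrow> cinner (adj G x) y = cinner x (G y)"
  by (metis cinner_adj cinner_commute)

lemma cinner_eqI: "(\<And>x. cinner x v = cinner x w) \<Longrightarrow> v = w"
  using cinner_self_eq_0_iff[of "v - w"] by (simp add: cinner_diff_right)

lemma bounded_op_adj:
  assumes G: "bounded_op G" shows "bounded_op (adj G)"
proof -
  obtain K where K: "\<And>x. norm (G x) \<le> K * norm x" using bounded_op_bound[OF G] by blast
  show ?thesis
  proof (rule bounded_opI[where K = "\<bar>K\<bar>"])
    fix x y c
    show "adj G (x + y) = adj G x + adj G y"
      by (rule cinner_eqI) (simp add: cinner_adj[OF G, symmetric] cinner_simps)
    show "adj G (scaleC c x) = scaleC c (adj G x)"
      by (rule cinner_eqI) (simp add: cinner_adj[OF G, symmetric] cinner_simps)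
    have "norm (adj G x) * norm (adj G x) = cmod (cinner (G (adj G x)) x)"
      by (simp only: cinner_adj[OF G] cinner_self norm_of_real) (simp add: power2_eq_square)
    also have "\<dots> \<le> norm (G (adj G x)) * norm x" by (rule cinner_Cauchy_Schwarz)
    also have "\<dots> \<le> (\<bar>K\<bar> * norm (adj G x)) * norm x"
      by (intro mult_right_mono order_trans[OF K]) simp_all
    finally have "norm (adj G x) * norm (adj G x) \<le> (\<bar>K\<bar> * norm x) * norm (adj G x)"
      by (simp only: ac_simps)
    then show "norm (adj G x) \<le> \<bar>K\<bar> * norm x"
      by (rule square_le_cancel) simp
  qed
qed

lemma adj_scale:
  assumes "bounded_op G" shows "adj (\<lambda>x. scaleC c (G x)) y = scaleC (cnj c) (adj G y)"
  by (rule cinner_eqI)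
    (simp add: cinner_adj[OF bounded_op_scale[OF assms], symmetric]
      cinner_adj[OF assms, symmetric] cinner_simps)

section \<open>Square roots of positive operators\<close>

lemma positive_op_bounded: "positive_op A \<Longrightarrow> bounded_op A"
  by (simp add: positive_op_def)

lemma positive_op_Re: "positive_op A \<Longrightarrow> 0 \<le> Re (cinner (A x) x)"
  and positive_op_Im: "positive_op A \<Longrightarrow> Im (cinner (A x) x) = 0"
  by (auto simp: positive_op_def complex_nonneg_Reals_iff)

text \<open>A form with real values on the diagonal is Hermitian, by polarization with \<open>x + y\<close> and \<open>x + \<i> y\<close>.\<close>

lemma positive_op_symmetric:
  assumes A: "positive_op A" shows "cinner (A x) y = cinner x (A y)"
proof -
  note add = bounded_op_add[OF positive_op_bounded[OF A]]
    bounded_op_scaleC[OF positive_op_bounded[OF A]]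
  have "Im (cinner (A x) y) + Im (cinner (A y) x) = 0"
    using positive_op_Im[OF A, of "x + y"] positive_op_Im[OF A, of x] positive_op_Im[OF A, of y]
    by (simp add: add cinner_simps)
  moreover have "Re (cinner (A y) x) = Re (cinner (A x) y)"
    using positive_op_Im[OF A, of "x + scaleC \<i> y"] positive_op_Im[OF A, of x]
      positive_op_Im[OF A, of y]
    by (simp add: add cinner_simps)
  ultimately have "cinner (A x) y = cnj (cinner (A y) x)" by (intro complex_eqI) auto
  then show ?thesis by (metis cinner_commute)
qed

text \<open>If \<open>\<langle>A z, z\<rangle> = 0\<close>, then \<open>z\<close> minimizes the form of \<open>A\<close>, so its derivative in the direction \<open>A z\<close>
vanishes.\<close>

lemma positive_op_kernel:
  assumes A: "positive_op A" and z: "Re (cinner (A z) z) = 0" shows "A z = 0"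
proof -
  note add = bounded_op_add[OF positive_op_bounded[OF A]]
    bounded_op_scaleC[OF positive_op_bounded[OF A]]
  have "0 \<le> t\<^sup>2 * Re (cinner (A (A z)) (A z)) + t * (2 * Re (cinner (A z) (A z)))" for t
  proof -
    have "Re (cinner (A (z + scaleC (of_real t) (A z))) (z + scaleC (of_real t) (A z)))
      = t\<^sup>2 * Re (cinner (A (A z)) (A z)) + t * (2 * Re (cinner (A z) (A z)))"
      using z positive_op_symmetric[OF A, of "A z" z]
      by (simp add: add cinner_simps algebra_simps power2_eq_square)
    then show ?thesis using positive_op_Re[OF A] by metis
  qed
  from linear_coeff_zero[OF this] show ?thesis
    by (simp add: cinner_self)
qed

text \<open>The square root of \<open>1 - T\<close> is \<open>1 - Y\<close>, where \<open>Y\<close> solves the fixed point equation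
\<open>Y = (T + Y\<^sup>2) / 2\<close>. The iterates below start at \<open>0\<close>; they are polynomials in \<open>T\<close>, so they commute
with everything that commutes with \<open>T\<close>.\<close>

primrec sqrt_iter :: "('a::complex_hilbert \<Rightarrow> 'a) \<Rightarrow> nat \<Rightarrow> 'a \<Rightarrow> 'a" where
  "sqrt_iter T 0 = (\<lambda>x. 0)"
| "sqrt_iter T (Suc n) = (\<lambda>x. scaleC (1/2) (T x + sqrt_iter T n (sqrt_iter T n x)))"

text \<open>The same iteration for the number \<open>T = 1\<close>. It increases and is bounded by \<open>1\<close>, and it controls
both the norms and the increments of the operator iteration for every contraction \<open>T\<close>.\<close>

primrec sqrt_majorant :: "nat \<Rightarrow> real" where
  "sqrt_majorant 0 = 0"
| "sqrt_majorant (Suc n) = (1 + (sqrt_majorant n)\<^sup>2) / 2"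

lemma sqrt_majorant_bounds: "0 \<le> sqrt_majorant n \<and> sqrt_majorant n \<le> 1"
proof (induction n)
  case (Suc n)
  then have "(sqrt_majorant n)\<^sup>2 \<le> 1" by (simp add: power_le_one)
  then show ?case by simp
qed simp

lemma sqrt_majorant_Suc: "sqrt_majorant n \<le> sqrt_majorant (Suc n)"
proof -
  have "0 \<le> (1 - sqrt_majorant n)\<^sup>2" by simp
  then show ?thesis by (simp add: power2_diff)
qed

lemma sqrt_majorant_Cauchy: "Cauchy sqrt_majorant"
proof -
  have "incseq sqrt_majorant" by (intro incseq_SucI sqrt_majorant_Suc)
  then obtain l where "sqrt_majorant \<longlonglongrightarrow> l"
    using incseq_convergent[of sqrt_majorant 1] sqrt_majorant_bounds by blast
  then show ?thesis by (rule LIMSEQ_imp_Cauchy)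
qed

context
  fixes T :: "'a::complex_hilbert \<Rightarrow> 'a"
  assumes T: "bounded_op T" and T_le: "\<And>x. norm (T x) \<le> norm x"
begin

lemma sqrt_iter_linear:
  "sqrt_iter T n (x + y) = sqrt_iter T n x + sqrt_iter T n y"
  "sqrt_iter T n (scaleC c x) = scaleC c (sqrt_iter T n x)"
proof (induction n arbitrary: x y)
  case (Suc n)
  {
    case 1 show ?case
      by (simp add: Suc bounded_op_add[OF T] scaleC_add_right[symmetric] add_ac)
  next
    case 2 show ?case
      by (simp add: Suc bounded_op_scaleC[OF T] scaleC_add_right scaleC_scaleC mult.commute)
  }
qed simp_all

lemma sqrt_iter_commute:
  assumes C: "bounded_op C" and "\<And>x. C (T x) = T (C x)"
  shows "C (sqrt_iter T n x) = sqrt_iter T n (C x)"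
  by (induction n arbitrary: x)
    (simp_all add: bounded_op_zero[OF C] bounded_op_add[OF C] bounded_op_scaleC[OF C] assms(2))

lemma sqrt_iter_symmetric:
  assumes "\<And>x y. cinner (T x) y = cinner x (T y)"
  shows "cinner (sqrt_iter T n x) y = cinner x (sqrt_iter T n y)"
  by (induction n arbitrary: x y) (simp_all add: cinner_simps assms)

lemma norm_sqrt_iter: "norm (sqrt_iter T n x) \<le> sqrt_majorant n * norm x"
proof (induction n arbitrary: x)
  case (Suc n)
  let ?Y = "sqrt_iter T n" and ?s = "sqrt_majorant n"
  have "norm (T x + ?Y (?Y x)) \<le> norm x + ?s * (?s * norm x)"
    using norm_triangle_ineq[of "T x" "?Y (?Y x)"] T_le[of x] Suc[of "?Y x"]
      mult_left_mono[OF Suc[of x], of ?s] sqrt_majorant_bounds[of n] by linarith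
  then show ?case by (simp add: norm_scaleC field_simps power2_eq_square)
qed simp

lemma sqrt_iter_diff: "sqrt_iter T n (x - y) = sqrt_iter T n x - sqrt_iter T n y"
  using sqrt_iter_linear(1)[of n "x - y" y] by simp

text \<open>With \<open>Y\<close> and \<open>Z\<close> consecutive iterates, \<open>Z\<^sup>2 - Y\<^sup>2 = Z (Z - Y) + (Z - Y) Y\<close>, and the majorants \<open>y\<close> and
\<open>z\<close> satisfy the corresponding identity \<open>z\<^sup>2 - y\<^sup>2 = (z + y) (z - y)\<close>.\<close>

lemma norm_sqrt_iter_step:
  "norm (sqrt_iter T (Suc n) x - sqrt_iter T n x)
    \<le> (sqrt_majorant (Suc n) - sqrt_majorant n) * norm x"
proof (induction n arbitrary: x)
  case 0
  then show ?case using T_le[of x] by (simp add: norm_scaleC)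
next
  case (Suc n)
  define Y Z y z where "Y = sqrt_iter T n" and "Z = sqrt_iter T (Suc n)"
    and "y = sqrt_majorant n" and "z = sqrt_majorant (Suc n)"
  have "sqrt_iter T (Suc (Suc n)) x - Z x = scaleC (1/2) (Z (Z x - Y x) + (Z (Y x) - Y (Y x)))"
    by (simp add: Z_def Y_def scaleC_diff_right[symmetric] sqrt_iter_diff
        del: sqrt_iter.simps(2)) (simp add: scaleC_diff_right[symmetric])
  also have "norm \<dots> \<le> (norm (Z (Z x - Y x)) + norm (Z (Y x) - Y (Y x))) / 2"
    by (simp add: norm_scaleC norm_triangle_ineq)
  also have "norm (Z (Z x - Y x)) \<le> z * ((z - y) * norm x)"
    using norm_sqrt_iter[of "Suc n" "Z x - Y x"] Suc.IH[of x]
      mult_left_mono[OF Suc.IH[of x], of z] sqrt_majorant_bounds[of "Suc n"]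
    unfolding Z_def Y_def z_def y_def by linarith
  also have "norm (Z (Y x) - Y (Y x)) \<le> (z - y) * (y * norm x)"
    using Suc.IH[of "Y x"] mult_left_mono[OF norm_sqrt_iter[of n x], of "z - y"]
      sqrt_majorant_Suc[of n]
    unfolding Z_def Y_def z_def y_def by linarith
  also have "(z * ((z - y) * norm x) + (z - y) * (y * norm x)) / 2
      = (sqrt_majorant (Suc (Suc n)) - z) * norm x"
    by (simp add: z_def y_def field_simps power2_eq_square)
  finally show ?case by (simp add: Z_def z_def)
qed

lemma norm_sqrt_iter_diff:
  "n \<le> m \<Longrightarrow> norm (sqrt_iter T m x - sqrt_iter T n x)
    \<le> (sqrt_majorant m - sqrt_majorant n) * norm x"
proof (induction m rule: dec_induct)
  case (step m)
  have "norm (sqrt_iter T (Suc m) x - sqrt_iter T n x)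
      \<le> norm (sqrt_iter T (Suc m) x - sqrt_iter T m x) + norm (sqrt_iter T m x - sqrt_iter T n x)"
    using norm_triangle_ineq[of "sqrt_iter T (Suc m) x - sqrt_iter T m x"
        "sqrt_iter T m x - sqrt_iter T n x"] by simp
  then show ?case using norm_sqrt_iter_step[of m x] step.IH unfolding left_diff_distrib by linarith
qed simp

lemma convergent_sqrt_iter: "convergent (\<lambda>n. sqrt_iter T n x)"
proof -
  have "Cauchy (\<lambda>n. sqrt_iter T n x)"
  proof (rule metric_CauchyI)
    fix e :: real assume e: "e > 0"
    have e': "e / (norm x + 1) > 0" using e by (simp add: add_nonneg_pos)
    obtain N where N: "\<And>m n. m \<ge> N \<Longrightarrow> n \<ge> N \<Longrightarrow>
        dist (sqrt_majorant m) (sqrt_majorant n) < e / (norm x + 1)"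
      using metric_CauchyD[OF sqrt_majorant_Cauchy e'] by metis
    have *: "norm (sqrt_iter T m x - sqrt_iter T n x) < e" if "n \<ge> N" "n \<le> m" for m n
    proof -
      have "norm (sqrt_iter T m x - sqrt_iter T n x)
          \<le> (sqrt_majorant m - sqrt_majorant n) * norm x"
        using norm_sqrt_iter_diff that by blast
      also have "\<dots> \<le> e / (norm x + 1) * norm x"
        using N[of m n] that by (intro mult_right_mono) (auto simp: dist_real_def)
      also have "\<dots> < e / (norm x + 1) * (norm x + 1)"
        using e' by (intro mult_strict_left_mono) auto
      also have "\<dots> = e" using add_nonneg_pos[OF norm_ge_zero[of x] zero_less_one] by simp
      finally show ?thesis .
    qed
    have "dist (sqrt_iter T m x) (sqrt_iter T n x) < e" if "m \<ge> N" "n \<ge> N" for m n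
      using *[of n m] *[of m n] that by (cases "n \<le> m") (auto simp: dist_norm norm_minus_commute)
    then show "\<exists>M. \<forall>m\<ge>M. \<forall>n\<ge>M. dist (sqrt_iter T m x) (sqrt_iter T n x) < e" by blast
  qed
  then show ?thesis by (simp add: Cauchy_convergent_iff)
qed

text \<open>The commutation clause is what makes the square root unique.\<close>

lemma positive_sqrt_exists:
  assumes sym: "\<And>x y. cinner (T x) y = cinner x (T y)"
  shows "\<exists>B. positive_op B \<and> (\<forall>x. B (B x) = x - T x)
    \<and> (\<forall>C. bounded_op C \<longrightarrow> (\<forall>x. C (T x) = T (C x)) \<longrightarrow> (\<forall>x. C (B x) = B (C x)))"
proof -
  define Y where "Y x = lim (\<lambda>n. sqrt_iter T n x)" for x
  have Y: "(\<lambda>n. sqrt_iter T n x) \<longlonglongrightarrow> Y x" for x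
    unfolding Y_def by (rule convergent_LIMSEQ_iff[THEN iffD1, OF convergent_sqrt_iter])
  have iter_le: "norm (sqrt_iter T n x) \<le> norm x" for n x
    using order_trans[OF norm_sqrt_iter[of n x] mult_right_mono[of "sqrt_majorant n" 1 "norm x"]]
      sqrt_majorant_bounds[of n] by auto
  have Y_le: "norm (Y x) \<le> norm x" for x
    by (rule LIMSEQ_le_const2[OF tendsto_norm[OF Y]]) (intro exI allI impI iter_le)
  have Y_add: "Y (x + y) = Y x + Y y" for x y
    using LIMSEQ_unique[OF Y[of "x + y"]] tendsto_add[OF Y[of x] Y[of y]]
    by (simp add: sqrt_iter_linear)
  have Y_scale: "Y (scaleC c x) = scaleC c (Y x)" for c x
    using LIMSEQ_unique[OF Y[of "scaleC c x"]]
      bounded_bilinear.tendsto[OF bounded_bilinear_scaleC tendsto_const Y[of x], of c]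
    by (simp add: sqrt_iter_linear)
  have Yb: "bounded_op Y"
    by (rule bounded_opI[where K = 1]) (simp_all add: Y_add Y_scale Y_le)
  have Y_sym: "cinner (Y x) y = cinner x (Y y)" for x y
    using LIMSEQ_unique[OF tendsto_cinner[OF Y[of x] tendsto_const, of y]]
      tendsto_cinner[OF tendsto_const Y[of y], of x]
    by (simp add: sqrt_iter_symmetric[OF sym])
  have "(\<lambda>n. sqrt_iter T n (sqrt_iter T n x)) \<longlonglongrightarrow> Y (Y x)" for x
  proof -
    have "(\<lambda>n. sqrt_iter T n x - Y x) \<longlonglongrightarrow> 0" by (rule LIM_zero[OF Y])
    then have "(\<lambda>n. sqrt_iter T n (sqrt_iter T n x - Y x)) \<longlonglongrightarrow> 0"
      by (rule Lim_null_comparison[OF always_eventually[OF allI[OF iter_le]] tendsto_norm_zero])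
    from tendsto_add[OF this Y[of "Y x"]] show ?thesis by (simp add: sqrt_iter_diff)
  qed
  then have "(\<lambda>n. sqrt_iter T (Suc n) x) \<longlonglongrightarrow> scaleC (1/2) (T x + Y (Y x))" for x
    unfolding sqrt_iter.simps
    by (intro bounded_bilinear.tendsto[OF bounded_bilinear_scaleC] tendsto_intros)
  then have fix_eq: "Y x = scaleC (1/2) (T x + Y (Y x))" for x
    using LIMSEQ_unique LIMSEQ_Suc[OF Y[of x]] by blast
  have two: "Y x + Y x = T x + Y (Y x)" for x
  proof -
    have "Y x + Y x = scaleC (1/2 + 1/2) (T x + Y (Y x))"
      unfolding scaleC_add_left using fix_eq[of x] by simp
    then show ?thesis by simp
  qed
  define B where "B x = x - Y x" for x
  have Bb: "bounded_op B" unfolding B_def by (rule bounded_op_sub[OF bounded_op_id Yb])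
  have "positive_op B"
    unfolding positive_op_def complex_nonneg_Reals_iff
  proof (intro conjI allI Bb)
    fix x
    have "Re (cinner (Y x) x) \<le> norm (Y x) * norm x"
      by (rule order_trans[OF complex_Re_le_cmod cinner_Cauchy_Schwarz])
    also have "\<dots> \<le> norm x * norm x" by (intro mult_right_mono Y_le) simp
    finally show "0 \<le> Re (cinner (B x) x)"
      by (simp add: B_def cinner_simps cinner_self power2_eq_square)
    have "cinner (B x) x = cnj (cinner (B x) x)"
      using cinner_commute[of "B x" x] by (simp add: B_def cinner_simps Y_sym)
    from arg_cong[OF this, of Im] show "Im (cinner (B x) x) = 0"
      unfolding cnj.simps by simp
  qed
  moreover have "B (B x) = x - T x" for x
  proof -
    have "B (B x) = x - (Y x + Y x) + Y (Y x)"
      by (simp add: B_def bounded_op_diff[OF Yb])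
    then show ?thesis by (simp add: two)
  qed
  moreover have "C (B x) = B (C x)" if C: "bounded_op C" and "\<forall>x. C (T x) = T (C x)" for C x
  proof -
    have "C (Y x) = Y (C x)"
    proof (rule LIMSEQ_unique)
      show "(\<lambda>n. C (sqrt_iter T n x)) \<longlonglongrightarrow> C (Y x)" by (rule bounded_op_tendsto[OF C Y])
      show "(\<lambda>n. C (sqrt_iter T n x)) \<longlonglongrightarrow> Y (C x)"
        using Y[of "C x"] by (simp only: sqrt_iter_commute[OF C that(2)[rule_format]])
    qed
    then show ?thesis by (simp add: B_def bounded_op_diff[OF C])
  qed
  ultimately show ?thesis by blast
qed

text \<open>If \<open>B\<close> is the root just constructed and \<open>C\<close> is another one, then \<open>C\<close> commutes with
\<open>T = 1 - C\<^sup>2\<close> and hence with \<open>B\<close>. So \<open>(B + C) z = (B\<^sup>2 - C\<^sup>2) x = 0\<close> for \<open>z = B x - C x\<close>; the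
two nonnegative numbers \<open>\<langle>B z, z\<rangle>\<close> and \<open>\<langle>C z, z\<rangle>\<close> vanish, hence so do \<open>B z\<close> and \<open>C z\<close>, and
\<open>\<parallel>z\<parallel>\<^sup>2 = \<langle>x, B z - C z\<rangle> = 0\<close>.\<close>

lemma sqrt_op_properties:
  assumes sym: "\<And>x y. cinner (T x) y = cinner x (T y)"
  shows "positive_op (sqrt_op (\<lambda>x. x - T x))"
    and "sqrt_op (\<lambda>x. x - T x) (sqrt_op (\<lambda>x. x - T x) x) = x - T x"
proof -
  obtain B where B: "positive_op B" "\<And>x. B (B x) = x - T x"
    and comm: "\<And>C x. bounded_op C \<Longrightarrow> (\<forall>x. C (T x) = T (C x)) \<Longrightarrow> C (B x) = B (C x)"
    using positive_sqrt_exists[OF sym] by blast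
  have uniq: "C = B" if C: "positive_op C" and sq: "C \<circ> C = (\<lambda>x. x - T x)" for C
  proof
    fix x
    have CC: "C (C x) = x - T x" for x using fun_cong[OF sq, of x] by simp
    note Cb = positive_op_bounded[OF C] and Bb = positive_op_bounded[OF B(1)]
    have "C (T x) = T (C x)" for x
    proof -
      have "C x - C (T x) = C x - T (C x)"
        using CC[of "C x"] by (simp add: CC bounded_op_diff[OF Cb])
      then show ?thesis by simp
    qed
    then have CB: "C (B x) = B (C x)" for x using comm[OF Cb] by blast
    define z where "z = B x - C x"
    have "B z + C z = 0"
      by (simp add: z_def bounded_op_diff[OF Cb] bounded_op_diff[OF Bb] CB CC B)
    then have "Re (cinner (B z) z) + Re (cinner (C z) z) = 0"
      unfolding plus_complex.simps(1)[symmetric] cinner_add_left[symmetric] by simp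
    then have zero: "Re (cinner (B z) z) = 0" "Re (cinner (C z) z) = 0"
      using positive_op_Re[OF B(1), of z] positive_op_Re[OF C, of z] by linarith+
    note positive_op_kernel[OF B(1) zero(1)] positive_op_kernel[OF C zero(2)]
    moreover have "cinner z z = cinner (B x) z - cinner (C x) z"
      by (simp only: cinner_diff_left[symmetric] z_def)
    then have "cinner z z = cinner x (B z) - cinner x (C z)"
      by (simp only: positive_op_symmetric[OF B(1)] positive_op_symmetric[OF C])
    ultimately have "z = 0" by (simp add: cinner_self_eq_0_iff)
    then show "C x = B x" by (simp add: z_def)
  qed
  have BB: "B \<circ> B = (\<lambda>x. x - T x)" using B(2) by (simp add: fun_eq_iff)
  have eq: "sqrt_op (\<lambda>x. x - T x) = B"
    unfolding sqrt_op_def by (rule the_equality) (use B(1) BB in simp, blast intro: uniq)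
  show "positive_op (sqrt_op (\<lambda>x. x - T x))"
    and "sqrt_op (\<lambda>x. x - T x) (sqrt_op (\<lambda>x. x - T x) x) = x - T x"
    unfolding eq by (rule B)+
qed

end

section \<open>Defect operators\<close>

context
  fixes P :: "'a::complex_hilbert \<Rightarrow> 'a"
  assumes P: "bounded_op P" and P_le: "\<And>x. norm (P x) \<le> norm x"
begin

lemma defect_op_properties:
  shows "positive_op (defect_op P)" and "defect_op P (defect_op P x) = x - adj P (P x)"
proof -
  have adj_le: "norm (adj P y) \<le> norm y" for y
  proof -
    have "norm (adj P y) * norm (adj P y) = cmod (cinner (P (adj P y)) y)"
      by (simp only: cinner_adj[OF P] cinner_self norm_of_real) (simp add: power2_eq_square)
    also have "\<dots> \<le> norm (P (adj P y)) * norm y" by (rule cinner_Cauchy_Schwarz)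
    also have "\<dots> \<le> norm (adj P y) * norm y" by (intro mult_right_mono P_le) simp
    finally have "norm (adj P y) * norm (adj P y) \<le> norm y * norm (adj P y)"
      by (simp only: ac_simps)
    then show ?thesis by (rule square_le_cancel) simp
  qed
  have le: "norm (adj P (P x)) \<le> norm x" for x by (rule order_trans[OF adj_le P_le])
  have sym: "cinner (adj P (P x)) y = cinner x (adj P (P y))" for x y
    by (simp add: cinner_adj_left[OF P] cinner_adj[OF P])
  note * = sqrt_op_properties[OF bounded_op_compose[OF bounded_op_adj[OF P] P] le sym]
  show "positive_op (defect_op P)" and "defect_op P (defect_op P x) = x - adj P (P x)"
    unfolding defect_op_def by (rule *)+
qed

lemma defect_op_bounded: "bounded_op (defect_op P)"
  by (rule positive_op_bounded[OF defect_op_properties(1)])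

lemma defect_op_symmetric: "cinner (defect_op P x) y = cinner x (defect_op P y)"
  by (rule positive_op_symmetric[OF defect_op_properties(1)])

lemma norm_defect_op: "(norm (defect_op P x))\<^sup>2 = (norm x)\<^sup>2 - (norm (P x))\<^sup>2"
proof -
  have "cinner (defect_op P x) (defect_op P x) = cinner x (x - adj P (P x))"
    by (simp only: defect_op_symmetric[of x] defect_op_properties(2))
  also have "\<dots> = cinner x x - cinner (P x) (P x)"
    by (simp only: cinner_diff_right cinner_adj[OF P, of x])
  finally show ?thesis unfolding power2_norm_eq_Re_cinner by simp
qed

end

section \<open>Operators dominated by a quadratic form\<close>

lemma polarization:
  assumes X: "bounded_op X"
  shows "4 * cinner (X h) k = cinner (X (h + k)) (h + k) - cinner (X (h - k)) (h - k)
    + \<i> * cinner (X (h + scaleC \<i> k)) (h + scaleC \<i> k)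
    - \<i> * cinner (X (h - scaleC \<i> k)) (h - scaleC \<i> k)"
  by (simp add: bounded_op_add[OF X] bounded_op_diff[OF X] bounded_op_scaleC[OF X] cinner_simps
      algebra_simps)

text \<open>The best choice is \<open>t\<^sup>2 = b / a\<close>. Adding a small \<open>d\<close> to numerator and denominator covers the cases
where \<open>a\<close> or \<open>b\<close> is zero.\<close>

lemma sum_of_squares_rescaled:
  fixes a b c C :: real
  assumes C: "C \<ge> 0" and a: "a \<ge> 0" and b: "b \<ge> 0"
    and le: "\<And>t. t > 0 \<Longrightarrow> c \<le> C * (t\<^sup>2 * a\<^sup>2 + b\<^sup>2 / t\<^sup>2)"
  shows "c \<le> 2 * C * a * b"
proof (rule field_le_epsilon)
  fix e :: real assume e: "e > 0"
  \<comment> \<open>the summand \<open>1\<close> keeps the denominator positive when \<open>C (a + b) = 0\<close>\<close>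
  define d where "d = e / (C * (a + b) + 1)"
  have pos: "C * (a + b) + 1 > 0" using C a b by (simp add: add_nonneg_pos)
  have d: "d > 0" using e pos by (simp add: d_def)
  define t where "t = sqrt ((b + d) / (a + d))"
  have ad: "a + d > 0" and bd: "b + d > 0" using a b d by auto
  have t2: "t\<^sup>2 = (b + d) / (a + d)" using ad bd by (simp add: t_def)
  have "t > 0" using ad bd by (simp add: t_def)
  have "t\<^sup>2 * a\<^sup>2 \<le> a * (b + d)"
  proof -
    have "a * a \<le> a * (a + d)" using a d by (intro mult_left_mono) auto
    then have "a * a / (a + d) \<le> a" using ad by (simp add: divide_le_eq)
    then have "(b + d) * (a * a / (a + d)) \<le> (b + d) * a" using bd by (intro mult_left_mono) auto
    then show ?thesis unfolding t2 by (simp add: power2_eq_square mult_ac)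
  qed
  moreover have "b\<^sup>2 / t\<^sup>2 \<le> b * (a + d)"
  proof -
    have "b * b \<le> b * (b + d)" using b d by (intro mult_left_mono) auto
    then have "b * b / (b + d) \<le> b" using bd by (simp add: divide_le_eq)
    then have "(a + d) * (b * b / (b + d)) \<le> (a + d) * b" using ad by (intro mult_left_mono) auto
    then show ?thesis unfolding t2 by (simp add: power2_eq_square mult_ac)
  qed
  ultimately have "C * (t\<^sup>2 * a\<^sup>2 + b\<^sup>2 / t\<^sup>2) \<le> C * (a * (b + d) + b * (a + d))"
    using C by (intro mult_left_mono) auto
  also have "\<dots> = 2 * C * a * b + (C * (a + b)) * d" by (simp add: algebra_simps)
  also have "(C * (a + b)) * d \<le> (C * (a + b) + 1) * d" using d by simp
  also have "(C * (a + b) + 1) * d = e" using pos by (simp add: d_def)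
  finally show "c \<le> 2 * C * a * b + e" using le[OF \<open>t > 0\<close>] by linarith
qed

text \<open>Polarization and the parallelogram law for \<open>D\<close> give the bound \<open>C (\<parallel>D h\<parallel>\<^sup>2 + \<parallel>D k\<parallel>\<^sup>2)\<close>. Replacing
\<open>h, k\<close> by \<open>t h, k / t\<close> leaves the left-hand side unchanged and optimizes the right-hand side.\<close>

lemma form_bound:
  assumes X: "bounded_op X" and D: "bounded_op D" and C: "C \<ge> 0"
    and le: "\<And>h. cmod (cinner (X h) h) \<le> C * (norm (D h))\<^sup>2"
  shows "cmod (cinner (X h) k) \<le> 2 * C * norm (D h) * norm (D k)"
proof (rule sum_of_squares_rescaled[OF C norm_ge_zero norm_ge_zero])
  have sum: "cmod (cinner (X h) k) \<le> C * ((norm (D h))\<^sup>2 + (norm (D k))\<^sup>2)" for h k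
  proof -
    have "4 * cmod (cinner (X h) k) = cmod (4 * cinner (X h) k)" by (simp add: norm_mult)
    also have "\<dots> \<le> cmod (cinner (X (h + k)) (h + k)) + cmod (cinner (X (h - k)) (h - k))
      + cmod (cinner (X (h + scaleC \<i> k)) (h + scaleC \<i> k))
      + cmod (cinner (X (h - scaleC \<i> k)) (h - scaleC \<i> k))"
    proof -
      have "cmod (p - q + \<i> * r - \<i> * s) \<le> cmod p + cmod q + cmod r + cmod s" for p q r s
        using norm_triangle_ineq4[of "p - q + \<i> * r" "\<i> * s"]
          norm_triangle_ineq[of "p - q" "\<i> * r"] norm_triangle_ineq4[of p q]
        by (simp add: norm_mult)
      then show ?thesis unfolding polarization[OF X] .
    qed
    also have "\<dots> \<le> C * (norm (D (h + k)))\<^sup>2 + C * (norm (D (h - k)))\<^sup>2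
      + C * (norm (D (h + scaleC \<i> k)))\<^sup>2 + C * (norm (D (h - scaleC \<i> k)))\<^sup>2"
      by (intro add_mono le)
    also have "\<dots> = 4 * (C * ((norm (D h))\<^sup>2 + (norm (D k))\<^sup>2))"
      by (simp add: bounded_op_add[OF D] bounded_op_diff[OF D] bounded_op_scaleC[OF D]
          norm_add_sq norm_diff_sq norm_scaleC algebra_simps)
    finally show ?thesis by simp
  qed
  fix t :: real assume t: "t > 0"
  have "cinner (X (scaleC (of_real t) h)) (scaleC (of_real (1 / t)) k) = cinner (X h) k"
    using t by (simp add: bounded_op_scaleC[OF X] cinner_simps)
  then show "cmod (cinner (X h) k) \<le> C * (t\<^sup>2 * (norm (D h))\<^sup>2 + (norm (D k))\<^sup>2 / t\<^sup>2)"
    using sum[of "scaleC (of_real t) h" "scaleC (of_real (1 / t)) k"] t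
    by (simp add: bounded_op_scaleC[OF D] norm_scaleC norm_divide power_mult_distrib power_divide)
qed

text \<open>Riesz' theorem is used twice. For fixed \<open>k\<close> it represents \<open>D h \<mapsto> \<langle>X h, k\<rangle>\<close> by a vector \<open>v k\<close>,
which is linear in \<open>k\<close> and bounded by \<open>C \<parallel>D k\<parallel>\<close>. For fixed \<open>y\<close> it then represents
\<open>D k \<mapsto> \<langle>v k, y\<rangle>\<close> by \<open>G y\<close>. This defines \<open>G\<close> on the whole closure at once, so no operator has to
be extended from the range by continuity.\<close>

lemma factor_through_closure_range:
  assumes X: "bounded_op X" and D: "bounded_op D"
    and sym: "\<And>x y. cinner (D x) y = cinner x (D y)" and C: "C \<ge> 0"
    and le: "\<And>h k. cmod (cinner (X h) k) \<le> C * norm (D h) * norm (D k)"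
  shows "\<exists>G\<in>bounded_ops (closure (range D)). \<forall>x. X x = D (G (D x))"
proof -
  let ?M = "closure (range D)"
  have "\<exists>v\<in>?M. (\<forall>h. cinner (X h) k = cinner (D h) v) \<and> norm v \<le> C * norm (D k)" for k
    by (rule riesz_factor[OF D])
      (use le C in \<open>simp_all add: bounded_op_add[OF X] bounded_op_scaleC[OF X] cinner_simps mult_ac\<close>)
  then obtain v where v: "\<And>k. v k \<in> ?M" "\<And>h k. cinner (X h) k = cinner (D h) (v k)"
    "\<And>k. norm (v k) \<le> C * norm (D k)" by metis
  have v_add: "v (h + k) = v h + v k" for h k
    by (rule eq_on_closure_range[OF D v(1) closure_range_add[OF D v(1) v(1)]])
      (simp only: cinner_add_right v(2)[symmetric])
  have v_scale: "v (scaleC c k) = scaleC c (v k)" for c k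
    by (rule eq_on_closure_range[OF D v(1) closure_range_scaleC[OF D v(1)]])
      (simp only: cinner_scaleC_right v(2)[symmetric])
  have "\<exists>w\<in>?M. (\<forall>k. cinner (v k) y = cinner (D k) w) \<and> norm w \<le> C * norm y" for y
  proof (rule riesz_factor[OF D])
    fix k
    have "cmod (cinner (v k) y) \<le> norm (v k) * norm y" by (rule cinner_Cauchy_Schwarz)
    also have "\<dots> \<le> (C * norm (D k)) * norm y" by (intro mult_right_mono v(3)) simp
    finally show "cmod (cinner (v k) y) \<le> C * norm y * norm (D k)" by (simp only: ac_simps)
  qed (simp_all add: v_add v_scale cinner_simps C)
  then obtain w where w: "\<And>y. w y \<in> ?M" "\<And>k y. cinner (v k) y = cinner (D k) (w y)"
    "\<And>y. norm (w y) \<le> C * norm y" by metis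
  have w_add: "w (x + y) = w x + w y" for x y
    by (rule eq_on_closure_range[OF D w(1) closure_range_add[OF D w(1) w(1)]])
      (simp only: cinner_add_right w(2)[symmetric])
  have w_scale: "w (scaleC c x) = scaleC c (w x)" for c x
    by (rule eq_on_closure_range[OF D w(1) closure_range_scaleC[OF D w(1)]])
      (simp only: cinner_scaleC_right w(2)[symmetric])
  have DM: "D k \<in> ?M" for k by (rule subsetD[OF closure_subset]) simp
  define G where "G = restrict w ?M"
  have "G \<in> bounded_ops ?M"
    unfolding bounded_ops_def G_def
    using w(1,3) by (auto simp: w_add w_scale closure_range_add[OF D] closure_range_scaleC[OF D])
  moreover have "X x = D (G (D x))" for x
  proof (rule cinner_eqI)
    fix k
    have "cinner k (D (w (D x))) = cinner (D k) (w (D x))" by (rule sym[symmetric])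
    also have "\<dots> = cinner (v k) (D x)" by (rule w(2)[symmetric])
    also have "\<dots> = cnj (cinner (X x) k)" by (simp only: v(2) cinner_commute[of "v k"])
    also have "\<dots> = cinner k (X x)" by (simp only: cinner_commute[of k])
    finally show "cinner k (X x) = cinner k (D (G (D x)))" by (simp add: G_def DM)
  qed
  ultimately show ?thesis by blast
qed

section \<open>Fundamental operators of a contractive pair\<close>

text \<open>The two inequalities say that the functions \<open>(a - z p) / (1 - z b)\<close> and \<open>(b - z p) / (1 - z a)\<close>,
which are bounded by \<open>1\<close> on the tetrablock, have contractive values at \<open>(A, B, P)\<close>. They are written
without inverses, since only this form enters below.\<close>
locale contractive_pair =
  fixes A B P :: "'a::complex_hilbert \<Rightarrow> 'a"
  assumes A: "bounded_op A" and B: "bounded_op B" and P: "bounded_op P"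
    and AP: "A (P x) = P (A x)" and BP: "B (P x) = P (B x)"
    and A_le: "cmod z < 1 \<Longrightarrow> norm (A x - scaleC z (P x)) \<le> norm (x - scaleC z (B x))"
    and B_le: "cmod z < 1 \<Longrightarrow> norm (B x - scaleC z (P x)) \<le> norm (x - scaleC z (A x))"
begin

lemma closed_disc_bound:
  assumes "\<And>z. cmod z < 1 \<Longrightarrow> norm (u - scaleC z (v::'a)) \<le> norm (x - scaleC z y)"
    and "cmod z \<le> 1"
  shows "norm (u - scaleC z v) \<le> norm (x - scaleC z y)"
proof -
  have "closed {z. norm (u - scaleC z v) \<le> norm (x - scaleC z y)}"
    by (intro closed_Collect_le continuous_intros continuous_on_scaleC)
  then have "closure (ball 0 1) \<subseteq> {z. norm (u - scaleC z v) \<le> norm (x - scaleC z y)}"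
    by (intro closure_minimal) (use assms(1) in auto)
  then show ?thesis using assms(2) by auto
qed

text \<open>Expanding the squares of the two inequalities on the unit circle.\<close>

lemma numerical_bound:
  assumes z: "cmod z = 1"
  shows "(norm x)\<^sup>2 - (norm (P x))\<^sup>2 + (norm (A x))\<^sup>2 - (norm (B x))\<^sup>2
      \<ge> 2 * Re (z * cinner (A x - adj B (P x)) x)"
    and "(norm x)\<^sup>2 - (norm (P x))\<^sup>2 + (norm (B x))\<^sup>2 - (norm (A x))\<^sup>2
      \<ge> 2 * Re (z * cinner (B x - adj A (P x)) x)"
proof -
  have *: "2 * Re (z * (cinner a x - cinner p b)) \<le> (norm x)\<^sup>2 - (norm p)\<^sup>2 + (norm a)\<^sup>2 - (norm b)\<^sup>2"
    if "norm (b - scaleC z p) \<le> norm (x - scaleC z a)" for a b p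
  proof -
    have "(norm (b - scaleC z p))\<^sup>2 \<le> (norm (x - scaleC z a))\<^sup>2"
      using that by (intro power_mono) auto
    moreover have "Re (cinner b (scaleC z p)) = Re (z * cinner p b)"
      using Re_cinner_commute[of b "scaleC z p"] by (simp add: cinner_scaleC_left)
    moreover have "Re (cinner x (scaleC z a)) = Re (z * cinner a x)"
      using Re_cinner_commute[of x "scaleC z a"] by (simp add: cinner_scaleC_left)
    ultimately show ?thesis
      using z unfolding norm_diff_sq norm_scaleC right_diff_distrib minus_complex.simps by simp
  qed
  show "(norm x)\<^sup>2 - (norm (P x))\<^sup>2 + (norm (A x))\<^sup>2 - (norm (B x))\<^sup>2
      \<ge> 2 * Re (z * cinner (A x - adj B (P x)) x)"
    unfolding cinner_diff_left cinner_adj_left[OF B]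
    by (rule *[OF closed_disc_bound[OF B_le]]) (simp_all add: z)
  show "(norm x)\<^sup>2 - (norm (P x))\<^sup>2 + (norm (B x))\<^sup>2 - (norm (A x))\<^sup>2
      \<ge> 2 * Re (z * cinner (B x - adj A (P x)) x)"
    unfolding cinner_diff_left cinner_adj_left[OF A]
    by (rule *[OF closed_disc_bound[OF A_le]]) (simp_all add: z)
qed

text \<open>The unimodular \<open>z\<close> and \<open>w\<close> that rotate the two numbers onto the positive axis are chosen
independently; in the sum of the two inequalities the terms \<open>\<parallel>A x\<parallel>\<^sup>2 - \<parallel>B x\<parallel>\<^sup>2\<close> cancel. The
right-hand side is \<open>\<parallel>D x\<parallel>\<^sup>2\<close>; in particular it is nonnegative, so \<open>P\<close> is a contraction.\<close>

lemma numerical_radius_bound: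
  "cmod (cinner (A x - adj B (P x)) x) \<le> (norm x)\<^sup>2 - (norm (P x))\<^sup>2"
  "cmod (cinner (B x - adj A (P x)) x) \<le> (norm x)\<^sup>2 - (norm (P x))\<^sup>2"
proof -
  have rot: "\<exists>z. cmod z = 1 \<and> z * c = of_real (cmod c)" for c
  proof (cases "c = 0")
    case False
    then show ?thesis
      by (intro exI[of _ "cnj c / of_real (cmod c)"])
        (simp add: norm_divide complex_norm_square[symmetric] mult.commute[of "cnj c"]
          power2_eq_square)
  qed (auto intro: exI[of _ 1])
  obtain z w where z: "cmod z = 1" "z * cinner (A x - adj B (P x)) x = of_real (cmod (cinner (A x - adj B (P x)) x))"
    and w: "cmod w = 1" "w * cinner (B x - adj A (P x)) x = of_real (cmod (cinner (B x - adj A (P x)) x))"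
    using rot by metis
  have ww: "cmod (- w) = 1" and zz: "cmod (- z) = 1" using w z by auto
  have "2 * cmod (cinner (A x - adj B (P x)) x)
      \<le> (norm x)\<^sup>2 - (norm (P x))\<^sup>2 + (norm (A x))\<^sup>2 - (norm (B x))\<^sup>2"
    using numerical_bound(1)[OF z(1), of x] unfolding z(2) by simp
  moreover have "2 * cmod (cinner (B x - adj A (P x)) x)
      \<le> (norm x)\<^sup>2 - (norm (P x))\<^sup>2 + (norm (B x))\<^sup>2 - (norm (A x))\<^sup>2"
    using numerical_bound(2)[OF w(1), of x] unfolding w(2) by simp
  moreover have "0 \<le> cmod (cinner (B x - adj A (P x)) x)" "0 \<le> cmod (cinner (A x - adj B (P x)) x)"
    by simp_all
  ultimately show "cmod (cinner (A x - adj B (P x)) x) \<le> (norm x)\<^sup>2 - (norm (P x))\<^sup>2"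
    and "cmod (cinner (B x - adj A (P x)) x) \<le> (norm x)\<^sup>2 - (norm (P x))\<^sup>2"
    by linarith+
qed

lemma P_le: "norm (P x) \<le> norm x"
proof (rule power2_le_imp_le)
  show "(norm (P x))\<^sup>2 \<le> (norm x)\<^sup>2"
    using order_trans[OF norm_ge_zero numerical_radius_bound(1)] by simp
qed simp

abbreviation D where "D \<equiv> defect_op P"
abbreviation M where "M \<equiv> defect_space P"

lemmas D_bounded = defect_op_bounded[OF P P_le]
lemmas D_sym = defect_op_symmetric[OF P P_le]
lemmas D_sq = defect_op_properties(2)[OF P P_le]
lemmas norm_D = norm_defect_op[OF P P_le]

lemma M_eq: "M = closure (range D)"
  by (simp add: defect_space_def)

lemma D_in_M: "D x \<in> M"
  unfolding M_eq by (rule subsetD[OF closure_subset]) simp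

lemma twisted_difference_bounded: "bounded_op (\<lambda>x. A x - adj B (P x))" "bounded_op (\<lambda>x. B x - adj A (P x))"
  by (rule bounded_op_sub[OF A bounded_op_compose[OF bounded_op_adj[OF B] P]]
      bounded_op_sub[OF B bounded_op_compose[OF bounded_op_adj[OF A] P]])+

lemma fundamental_exist:
  "\<exists>G\<in>bounded_ops M. \<forall>x. A x - adj B (P x) = D (G (D x))"
  "\<exists>H\<in>bounded_ops M. \<forall>x. B x - adj A (P x) = D (H (D x))"
proof -
  have *: "\<exists>G\<in>bounded_ops M. \<forall>x. X x = D (G (D x))"
    if X: "bounded_op X" and le: "\<And>x. cmod (cinner (X x) x) \<le> (norm x)\<^sup>2 - (norm (P x))\<^sup>2" for X
    unfolding M_eq
  proof (rule factor_through_closure_range[OF X D_bounded D_sym, of 2])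
    show "cmod (cinner (X h) k) \<le> 2 * norm (D h) * norm (D k)" for h k
      using form_bound[OF X D_bounded, of 1] le by (simp add: norm_D)
  qed simp_all
  show "\<exists>G\<in>bounded_ops M. \<forall>x. A x - adj B (P x) = D (G (D x))"
    by (rule *[OF twisted_difference_bounded(1) numerical_radius_bound(1)])
  show "\<exists>H\<in>bounded_ops M. \<forall>x. B x - adj A (P x) = D (H (D x))"
    by (rule *[OF twisted_difference_bounded(2) numerical_radius_bound(2)])
qed

text \<open>\<open>F\<close> and \<open>G\<close> agree on the range of \<open>D\<close>, since both take values in its closure. Their adjoints
therefore agree on that range too, and a vector of \<open>M\<close> is determined by its inner products with
the range.\<close>

lemma eq_on_defect_space:
  assumes F: "F \<in> bounded_ops M" and G: "G \<in> bounded_ops M"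
    and eq: "\<And>x. D (F (D x)) = D (G (D x))"
  shows "F = G"
proof
  fix y
  have maps: "F \<in> M \<rightarrow>\<^sub>E M" "G \<in> M \<rightarrow>\<^sub>E M" using F G by (simp_all add: bounded_ops_def)
  show "F y = G y"
  proof (cases "y \<in> M")
    case True
    have on_range: "F (D x) = G (D x)" for x
    proof (rule eq_on_closure_range[OF D_bounded])
      show "F (D x) \<in> closure (range D)" "G (D x) \<in> closure (range D)"
        using PiE_mem[OF maps(1) D_in_M] PiE_mem[OF maps(2) D_in_M] by (simp_all add: M_eq)
      show "cinner (D k) (F (D x)) = cinner (D k) (G (D x))" for k
        by (simp only: D_sym eq)
    qed
    have in_M: "F y \<in> M" "G y \<in> M" by (rule PiE_mem[OF maps(1) True] PiE_mem[OF maps(2) True])+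
    show ?thesis
    proof (rule eq_on_closure_range[OF D_bounded])
      show "F y \<in> closure (range D)" "G y \<in> closure (range D)"
        using in_M by (simp_all add: M_eq)
      fix k
      note aF = adj_on_closure_range[OF D_bounded M_eq F D_in_M]
        and aG = adj_on_closure_range[OF D_bounded M_eq G D_in_M]
      have "adj_on M F (D k) = adj_on M G (D k)"
      proof (rule eq_on_closure_range[OF D_bounded])
        show "adj_on M F (D k) \<in> closure (range D)" "adj_on M G (D k) \<in> closure (range D)"
          using aF(1) aG(1) by (simp_all only: M_eq)
        show "cinner (D x) (adj_on M F (D k)) = cinner (D x) (adj_on M G (D k))" for x
          by (simp only: aF(2)[OF D_in_M, symmetric] aG(2)[OF D_in_M, symmetric] on_range)
      qed
      then have "cinner (F y) (D k) = cinner (G y) (D k)"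
        by (simp only: aF(2)[OF True] aG(2)[OF True])
      then show "cinner (D k) (F y) = cinner (D k) (G y)"
        by (simp only: cinner_commute[of "D k"])
    qed
  next
    case False
    then show ?thesis by (simp only: PiE_arb[OF maps(1) False] PiE_arb[OF maps(2) False])
  qed
qed

text \<open>\<open>\<parallel>D P\<^sup>n x\<parallel>\<^sup>2 = \<parallel>P\<^sup>n x\<parallel>\<^sup>2 - \<parallel>P\<^bsup>n+1\<^esup> x\<parallel>\<^sup>2\<close> is the increment of a convergent sequence.\<close>

lemma norm_D_power_tendsto: "(\<lambda>n. norm (D ((P ^^ n) x))) \<longlonglongrightarrow> 0"
proof -
  define a where "a n = (norm ((P ^^ n) x))\<^sup>2" for n
  have "decseq a" unfolding a_def by (intro decseq_SucI power_mono) (simp_all add: P_le)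
  then obtain l where l: "a \<longlonglongrightarrow> l"
    using decseq_convergent[of a 0] by (auto simp: a_def)
  have "(\<lambda>n. a n - a (Suc n)) \<longlonglongrightarrow> l - l" by (intro tendsto_diff l LIMSEQ_Suc)
  then have "(\<lambda>n. (norm (D ((P ^^ n) x)))\<^sup>2) \<longlonglongrightarrow> 0"
    by (simp add: norm_D a_def)
  from tendsto_real_sqrt[OF this] show ?thesis by simp
qed

text \<open>Let \<open>X = D F D - (A - B\<^sup>* P)\<close> and \<open>Y = D H D - (B - A\<^sup>* P)\<close> measure the failure of the fundamental
equations; \<open>\<xi>\<close> and \<open>\<eta>\<close> in the proof are their forms. Multiplying the system by \<open>D\<close>, which is
injective on \<open>M\<close>, and using \<open>D\<^sup>2 = 1 - P\<^sup>* P\<close> together with commutativity turns it into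
\<open>X + Y\<^sup>* P = 0\<close> and \<open>Y + X\<^sup>* P = 0\<close>. If \<open>X\<close> and \<open>Y\<close> vanish, the system holds. Conversely, the system
gives \<open>X = P\<^sup>* X P\<close>, so \<open>\<langle>X k, h\<rangle> = \<langle>X P\<^sup>n k, P\<^sup>n h\<rangle>\<close> for all \<open>n\<close>. Since \<open>A - B\<^sup>* P\<close> itself factors
through \<open>D\<close>, this is at most \<open>C \<parallel>D P\<^sup>n k\<parallel> \<parallel>D P\<^sup>n h\<parallel>\<close>, which tends to zero.\<close>

lemma equations_iff:
  assumes F: "F \<in> bounded_ops M" and H: "H \<in> bounded_ops M"
  shows "(\<forall>x. A x - adj B (P x) = D (F (D x)) \<and> B x - adj A (P x) = D (H (D x)))
    \<longleftrightarrow> (\<forall>x. D (A x) = F (D x) + adj_on M H (D (P x)) \<and> D (B x) = H (D x) + adj_on M F (D (P x)))"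
proof -
  have maps: "F (D x) \<in> M" "H (D x) \<in> M" for x
    by (rule PiE_mem[OF _ D_in_M], use F H in \<open>simp add: bounded_ops_def\<close>)+
  note aF = adj_on_closure_range[OF D_bounded M_eq F D_in_M]
    and aH = adj_on_closure_range[OF D_bounded M_eq H D_in_M]
  have M_add: "x \<in> M \<Longrightarrow> y \<in> M \<Longrightarrow> x + y \<in> M" for x y
    unfolding M_eq by (rule closure_range_add[OF D_bounded])
  define \<xi> where "\<xi> h k = cinner (D h) (F (D k)) - cinner h (A k - adj B (P k))" for h k
  define \<eta> where "\<eta> h k = cinner (D h) (H (D k)) - cinner h (B k - adj A (P k))" for h k
  have system_A: "D (A k) = F (D k) + adj_on M H (D (P k)) \<longleftrightarrow> (\<forall>h. \<xi> h k + cnj (\<eta> (P k) h) = 0)" for k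
  proof -
    have "\<xi> h k + cnj (\<eta> (P k) h)
        = cinner (D h) (F (D k) + adj_on M H (D (P k))) - cinner (D h) (D (A k))" for h
    proof -
      have "cnj (cinner (D (P k)) (H (D h))) = cinner (D h) (adj_on M H (D (P k)))"
        by (simp only: aH(2)[OF D_in_M, symmetric] cinner_commute[of "H (D h)"])
      moreover have "cnj (cinner (P k) (B h)) = cinner h (adj B (P k))"
        by (simp only: cinner_adj[OF B, symmetric] cinner_commute[of "B h"])
      moreover have "cnj (cinner (P k) (adj A (P h))) = cinner h (adj P (P (A k)))"
        by (simp only: cinner_adj[OF A, symmetric] cinner_adj[OF P, symmetric] AP
            cinner_commute[of "P h"])
      ultimately show ?thesis
        by (simp add: \<xi>_def \<eta>_def cinner_diff_right cinner_add_right D_sym[of h "D (A k)"] D_sq)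
    qed
    then show ?thesis
      using eq_on_closure_range[OF D_bounded, of "D (A k)" "F (D k) + adj_on M H (D (P k))"]
        M_add[OF maps(1) aH(1), of k "P k"] D_in_M[of "A k"] unfolding M_eq by auto
  qed
  have system_B: "D (B k) = H (D k) + adj_on M F (D (P k)) \<longleftrightarrow> (\<forall>h. \<eta> h k + cnj (\<xi> (P k) h) = 0)" for k
  proof -
    have "\<eta> h k + cnj (\<xi> (P k) h)
        = cinner (D h) (H (D k) + adj_on M F (D (P k))) - cinner (D h) (D (B k))" for h
    proof -
      have "cnj (cinner (D (P k)) (F (D h))) = cinner (D h) (adj_on M F (D (P k)))"
        by (simp only: aF(2)[OF D_in_M, symmetric] cinner_commute[of "F (D h)"])
      moreover have "cnj (cinner (P k) (A h)) = cinner h (adj A (P k))"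
        by (simp only: cinner_adj[OF A, symmetric] cinner_commute[of "A h"])
      moreover have "cnj (cinner (P k) (adj B (P h))) = cinner h (adj P (P (B k)))"
        by (simp only: cinner_adj[OF B, symmetric] cinner_adj[OF P, symmetric] BP
            cinner_commute[of "P h"])
      ultimately show ?thesis
        by (simp add: \<xi>_def \<eta>_def cinner_diff_right cinner_add_right D_sym[of h "D (B k)"] D_sq)
    qed
    then show ?thesis
      using eq_on_closure_range[OF D_bounded, of "D (B k)" "H (D k) + adj_on M F (D (P k))"]
        M_add[OF maps(2) aF(1), of k "P k"] D_in_M[of "B k"] unfolding M_eq by auto
  qed
  have fund_A: "A k - adj B (P k) = D (F (D k)) \<longleftrightarrow> (\<forall>h. \<xi> h k = 0)" for k
    unfolding \<xi>_def D_sym using cinner_eqI[of "D (F (D k))" "A k - adj B (P k)"] by auto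
  have fund_B: "B k - adj A (P k) = D (H (D k)) \<longleftrightarrow> (\<forall>h. \<eta> h k = 0)" for k
    unfolding \<eta>_def D_sym using cinner_eqI[of "D (H (D k))" "B k - adj A (P k)"] by auto
  have bound: "\<exists>C. \<forall>h k. cmod (\<xi> h k) \<le> C * norm (D h) * norm (D k)"
  proof -
    obtain G where G: "G \<in> bounded_ops M" "\<And>x. A x - adj B (P x) = D (G (D x))"
      using fundamental_exist(1) by blast
    obtain K where K: "\<And>x. x \<in> M \<Longrightarrow> norm (F x) \<le> K * norm x"
      using F unfolding bounded_ops_def by force
    obtain L where L: "\<And>x. x \<in> M \<Longrightarrow> norm (G x) \<le> L * norm x"
      using G(1) unfolding bounded_ops_def by force
    have "cmod (\<xi> h k) \<le> (K + L) * norm (D h) * norm (D k)" for h k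
    proof -
      have "\<xi> h k = cinner (D h) (F (D k) - G (D k))"
        by (simp add: \<xi>_def G(2) D_sym cinner_diff_right)
      also have "cmod \<dots> \<le> norm (D h) * norm (F (D k) - G (D k))" by (rule cinner_Cauchy_Schwarz)
      also have "\<dots> \<le> norm (D h) * (K * norm (D k) + L * norm (D k))"
        by (intro mult_left_mono order_trans[OF norm_triangle_ineq4] add_mono K L D_in_M) simp
      finally show ?thesis by (simp add: algebra_simps)
    qed
    then show ?thesis by blast
  qed
  show ?thesis
  proof
    assume "\<forall>x. A x - adj B (P x) = D (F (D x)) \<and> B x - adj A (P x) = D (H (D x))"
    then show "\<forall>x. D (A x) = F (D x) + adj_on M H (D (P x)) \<and> D (B x) = H (D x) + adj_on M F (D (P x))"
      unfolding system_A system_B fund_A fund_B by simp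
  next
    assume "\<forall>x. D (A x) = F (D x) + adj_on M H (D (P x)) \<and> D (B x) = H (D x) + adj_on M F (D (P x))"
    then have sys: "\<xi> h k + cnj (\<eta> (P k) h) = 0" "\<eta> h k + cnj (\<xi> (P k) h) = 0" for h k
      unfolding system_A system_B by simp_all
    have step: "\<xi> h k = \<xi> (P h) (P k)" for h k
    proof -
      have "\<xi> h k = - cnj (\<eta> (P k) h)" using sys(1)[of h k] by (simp add: eq_neg_iff_add_eq_0)
      also have "\<eta> (P k) h = - cnj (\<xi> (P h) (P k))"
        using sys(2)[of "P k" h] by (simp add: eq_neg_iff_add_eq_0)
      finally show ?thesis by simp
    qed
    have iterate: "\<xi> h k = \<xi> ((P ^^ n) h) ((P ^^ n) k)" for h k n
      by (induction n) (simp_all add: step[symmetric])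
    have zero: "\<xi> h k = 0" for h k
    proof -
      obtain C where C: "\<And>h k. cmod (\<xi> h k) \<le> C * norm (D h) * norm (D k)" using bound by blast
      have "(\<lambda>n. C * norm (D ((P ^^ n) h)) * norm (D ((P ^^ n) k))) \<longlonglongrightarrow> C * 0 * 0"
        by (intro tendsto_mult tendsto_const norm_D_power_tendsto)
      moreover have "cmod (\<xi> h k) \<le> C * norm (D ((P ^^ n) h)) * norm (D ((P ^^ n) k))" for n
        using C[of "(P ^^ n) h" "(P ^^ n) k"] iterate[of h k n] by simp
      ultimately have "cmod (\<xi> h k) \<le> C * 0 * 0"
        by (intro LIMSEQ_le_const) auto
      then show ?thesis by simp
    qed
    then have "\<eta> h k = 0" for h k using sys(2)[of h k] by simp
    with zero show "\<forall>x. A x - adj B (P x) = D (F (D x)) \<and> B x - adj A (P x) = D (H (D x))"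
      unfolding fund_A fund_B by simp
  qed
qed

end

section \<open>Polynomials without zeros in the polydisc\<close>

lemma linear_zero_free:
  fixes a b :: complex
  assumes "\<And>z. cmod z < 1 \<Longrightarrow> a - b * z \<noteq> 0"
  shows "a \<noteq> 0" "cmod b \<le> cmod a"
proof -
  show "a \<noteq> 0" using assms[of 0] by simp
  show "cmod b \<le> cmod a"
  proof (rule ccontr)
    assume "\<not> cmod b \<le> cmod a"
    then have "cmod (a / b) < 1" "b \<noteq> 0"
      by (auto simp: norm_divide divide_less_eq intro: le_less_trans[OF norm_ge_zero])
    then show False using assms[of "a / b"] by simp
  qed
qed

text \<open>The numbers \<open>\<alpha>\<close> and \<open>\<beta>\<close> are the reciprocal roots, with the value \<open>0\<close> for a missing root.\<close>

lemma quadratic_zero_free: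
  fixes a b c :: complex
  assumes "\<And>z. cmod z < 1 \<Longrightarrow> a - b * z + c * z\<^sup>2 \<noteq> 0"
  obtains \<alpha> \<beta> where "a \<noteq> 0" "cmod \<alpha> \<le> 1" "cmod \<beta> \<le> 1" "b = a * (\<alpha> + \<beta>)" "c = a * (\<alpha> * \<beta>)"
proof -
  have a: "a \<noteq> 0" using assms[of 0] by simp
  define s p where "s = b / a" and "p = c / a"
  define r where "r = csqrt (s\<^sup>2 - 4 * p)"
  define \<alpha> \<beta> where "\<alpha> = (s + r) / 2" and "\<beta> = (s - r) / 2"
  have r: "r\<^sup>2 = s\<^sup>2 - 4 * p" by (simp add: r_def)
  have sum: "\<alpha> + \<beta> = s" by (simp add: \<alpha>_def \<beta>_def add_divide_distrib[symmetric])
  have "4 * (\<alpha> * \<beta>) = s\<^sup>2 - r\<^sup>2" by (simp add: \<alpha>_def \<beta>_def power2_eq_square field_simps)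
  then have prod: "\<alpha> * \<beta> = p" by (simp add: r)
  have b: "b = a * (\<alpha> + \<beta>)" and c: "c = a * (\<alpha> * \<beta>)" using a by (simp_all add: sum prod s_def p_def)
  have "a - b * z + c * z\<^sup>2 = a * ((1 - \<alpha> * z) * (1 - \<beta> * z))" for z
    unfolding b c by (simp add: algebra_simps power2_eq_square)
  then have nz: "1 - \<alpha> * z \<noteq> 0" "1 - \<beta> * z \<noteq> 0" if "cmod z < 1" for z
    using assms[OF that] by auto
  have "cmod \<alpha> \<le> 1" "cmod \<beta> \<le> 1"
    using linear_zero_free(2)[of 1 \<alpha>] linear_zero_free(2)[of 1 \<beta>] nz by auto
  with a b c show thesis using that by blast
qed

text \<open>The quotient \<open>c / a\<close> is the product of the reciprocal roots. Applied to a polynomial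
\<open>a + b\<^sub>1 u + b\<^sub>2 v + c u v\<close> on the diagonal \<open>u = v\<close>, this is Asano's contraction.\<close>

lemma quadratic_zero_free_coeff:
  fixes a b c :: complex
  assumes "\<And>z. cmod z < 1 \<Longrightarrow> a - b * z + c * z\<^sup>2 \<noteq> 0"
  shows "a \<noteq> 0 \<and> cmod c \<le> cmod a"
proof -
  obtain \<alpha> \<beta> where f: "a \<noteq> 0" "cmod \<alpha> \<le> 1" "cmod \<beta> \<le> 1" "c = a * (\<alpha> * \<beta>)"
    using quadratic_zero_free[OF assms] by metis
  have "cmod \<alpha> * cmod \<beta> \<le> 1 * 1" using f by (intro mult_mono) auto
  then have "cmod a * (cmod \<alpha> * cmod \<beta>) \<le> cmod a * 1" by (intro mult_left_mono) auto
  with f show ?thesis by (simp add: norm_mult)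
qed

lemma moebius_norm_identity:
  fixes a v :: complex
  shows "(cmod (1 - a * v))\<^sup>2 - (cmod (a - cnj v))\<^sup>2 = (1 - (cmod a)\<^sup>2) * (1 - (cmod v)\<^sup>2)"
proof -
  have "complex_of_real ((cmod (1 - a * v))\<^sup>2 - (cmod (a - cnj v))\<^sup>2)
      = complex_of_real ((1 - (cmod a)\<^sup>2) * (1 - (cmod v)\<^sup>2))"
    unfolding of_real_diff of_real_mult of_real_1 complex_norm_square
    by (simp add: algebra_simps)
  then show ?thesis by (simp only: of_real_eq_iff)
qed

lemma moebius_norm_le:
  fixes a v :: complex
  assumes "cmod a \<le> 1" "cmod v \<le> 1"
  shows "cmod (a - cnj v) \<le> cmod (1 - a * v)"
proof (rule power2_le_imp_le)
  have "0 \<le> (1 - (cmod a)\<^sup>2) * (1 - (cmod v)\<^sup>2)"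
    using assms by (intro mult_nonneg_nonneg) (simp_all add: power_le_one)
  then show "(cmod (a - cnj v))\<^sup>2 \<le> (cmod (1 - a * v))\<^sup>2"
    unfolding moebius_norm_identity[symmetric] by simp
qed simp

text \<open>The quadratic \<open>(1 - \<alpha> z) (1 - \<beta> z)\<close>, polarized to a symmetric function of two variables; the claim
is the theorem of Grace, Walsh and Szego in degree two. A zero would mean \<open>m \<alpha> + m \<beta> = 0\<close> for the
Moebius map \<open>m \<gamma> = (1 - \<gamma> u) / (1 - \<gamma> v)\<close>. But \<open>m\<close> maps the closed unit disc into a disc that does
not contain \<open>0\<close>: its centre is \<open>c / r\<close>, its radius \<open>\<bar>v - u\<bar> / r\<close>, and \<open>\<bar>v - u\<bar> < \<bar>c\<bar>\<close>. So the
midpoint of \<open>m \<alpha>\<close> and \<open>m \<beta>\<close> is not \<open>0\<close>.\<close>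

lemma polarized_quadratic_zero_free:
  fixes \<alpha> \<beta> u v :: complex
  assumes \<alpha>: "cmod \<alpha> \<le> 1" and \<beta>: "cmod \<beta> \<le> 1" and u: "cmod u < 1" and v: "cmod v < 1"
  shows "1 - (\<alpha> + \<beta>) / 2 * (u + v) + \<alpha> * \<beta> * (u * v) \<noteq> 0"
proof
  assume zero: "1 - (\<alpha> + \<beta>) / 2 * (u + v) + \<alpha> * \<beta> * (u * v) = 0"
  define r where "r = 1 - (cmod v)\<^sup>2"
  have r: "r > 0" using v by (simp add: r_def power_less_one_iff abs_square_less_1)
  have r': "complex_of_real r = 1 - v * cnj v" 
    unfolding r_def of_real_diff complex_norm_square by simp
  define c where "c = 1 - cnj v * u"
  have nz: "1 - \<gamma> * v \<noteq> 0" if "cmod \<gamma> \<le> 1" for \<gamma>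
  proof
    assume "1 - \<gamma> * v = 0"
    then have "cmod (\<gamma> * v) = 1" by simp
    moreover have "cmod \<gamma> * cmod v \<le> 1 * cmod v" using that by (intro mult_right_mono) auto
    ultimately show False using v by (simp add: norm_mult)
  qed
  define m where "m \<gamma> = (1 - \<gamma> * u) / (1 - \<gamma> * v)" for \<gamma>
  have far: "cmod (v - u) < cmod c"
  proof (rule power2_less_imp_less)
    have "(cmod (1 - u * cnj v))\<^sup>2 - (cmod (u - v))\<^sup>2 = (1 - (cmod u)\<^sup>2) * (1 - (cmod v)\<^sup>2)"
      using moebius_norm_identity[of u "cnj v"] by simp
    moreover have "(1 - (cmod u)\<^sup>2) * (1 - (cmod v)\<^sup>2) > 0"
      using u v by (intro mult_pos_pos) (simp_all add: abs_square_less_1)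
    ultimately show "(cmod (v - u))\<^sup>2 < (cmod c)\<^sup>2"
      by (simp add: c_def norm_minus_commute mult.commute)
  qed simp
  have near: "cmod (of_real r * m \<gamma> - c) \<le> cmod (v - u)" if \<gamma>: "cmod \<gamma> \<le> 1" for \<gamma>
  proof -
    have "of_real r * m \<gamma> - c = ((1 - v * cnj v) * (1 - \<gamma> * u) - c * (1 - \<gamma> * v)) / (1 - \<gamma> * v)"
      using nz[OF \<gamma>] unfolding m_def r' by (simp add: field_simps)
    also have "(1 - v * cnj v) * (1 - \<gamma> * u) - c * (1 - \<gamma> * v) = (v - u) * (\<gamma> - cnj v)"
      by (simp add: c_def algebra_simps)
    finally have "cmod (of_real r * m \<gamma> - c) = cmod (v - u) * (cmod (\<gamma> - cnj v) / cmod (1 - \<gamma> * v))"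
      by (simp add: norm_divide norm_mult)
    also have "\<dots> \<le> cmod (v - u) * 1"
      using moebius_norm_le[OF \<gamma>, of v] v nz[OF \<gamma>] by (intro mult_left_mono) (simp_all add: divide_le_eq)
    finally show ?thesis by simp
  qed
  have sum: "m \<alpha> + m \<beta> = 0"
  proof -
    have "(1 - \<alpha> * u) * (1 - \<beta> * v) + (1 - \<beta> * u) * (1 - \<alpha> * v)
        = 2 * (1 - (\<alpha> + \<beta>) / 2 * (u + v) + \<alpha> * \<beta> * (u * v))"
      by (simp add: algebra_simps)
    also have "\<dots> = 0" by (simp only: zero mult_zero_right)
    finally have "(1 - \<alpha> * u) * (1 - \<beta> * v) + (1 - \<beta> * u) * (1 - \<alpha> * v) = 0" .
    then show ?thesis using nz[OF \<alpha>] nz[OF \<beta>] by (simp add: m_def add_frac_eq)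
  qed
  have "(of_real r * m \<alpha> - c) + (of_real r * m \<beta> - c) = of_real r * (m \<alpha> + m \<beta>) - 2 * c"
    by (simp add: algebra_simps)
  then have "(of_real r * m \<alpha> - c) + (of_real r * m \<beta> - c) = - (2 * c)"
    by (simp add: sum)
  then have "cmod (- (2 * c)) \<le> cmod (of_real r * m \<alpha> - c) + cmod (of_real r * m \<beta> - c)"
    using norm_triangle_ineq[of "of_real r * m \<alpha> - c" "of_real r * m \<beta> - c"] by simp
  then have "2 * cmod c \<le> cmod (of_real r * m \<alpha> - c) + cmod (of_real r * m \<beta> - c)"
    by (simp add: norm_mult)
  then show False using far near[OF \<alpha>] near[OF \<beta>] by linarith
qed

section \<open>The zero condition of the tetrablock\<close>

text \<open>This condition describes the closed tetrablock.\<close>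

definition tetrablock_zero_free :: "complex \<Rightarrow> complex \<Rightarrow> complex \<Rightarrow> bool" where
  "tetrablock_zero_free a b p \<longleftrightarrow>
    (\<forall>z w. cmod z < 1 \<longrightarrow> cmod w < 1 \<longrightarrow> 1 - z * a - w * b + z * w * p \<noteq> 0)"

lemma tetrablock_zero_free_commute: "tetrablock_zero_free a b p \<Longrightarrow> tetrablock_zero_free b a p"
  unfolding tetrablock_zero_free_def
proof (intro allI impI)
  fix z w
  assume *: "\<forall>z w. cmod z < 1 \<longrightarrow> cmod w < 1 \<longrightarrow> 1 - z * a - w * b + z * w * p \<noteq> 0"
    and z: "cmod z < 1" and w: "cmod w < 1"
  have "1 - w * a - z * b + w * z * p \<noteq> 0" using *[rule_format, OF w z] .
  moreover have "1 - w * a - z * b + w * z * p = 1 - z * b - w * a + z * w * p" by (simp add: algebra_simps)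
  ultimately show "1 - z * b - w * a + z * w * p \<noteq> 0" by (simp only: not_False_eq_True)
qed

lemma tetrablock_zero_free_bound:
  assumes "tetrablock_zero_free a b p" and z: "cmod z < 1"
  shows "1 - z * a \<noteq> 0" "cmod (b - z * p) \<le> cmod (1 - z * a)"
proof -
  have "(1 - z * a) - (b - z * p) * w \<noteq> 0" if "cmod w < 1" for w
  proof -
    have "1 - z * a - w * b + z * w * p \<noteq> 0"
      using assms(1) unfolding tetrablock_zero_free_def using z that by blast
    moreover have "(1 - z * a) - (b - z * p) * w = 1 - z * a - w * b + z * w * p"
      by (simp add: algebra_simps)
    ultimately show ?thesis by (simp only: not_False_eq_True)
  qed
  from linear_zero_free[OF this] show "1 - z * a \<noteq> 0" "cmod (b - z * p) \<le> cmod (1 - z * a)"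
    by blast+
qed

lemma tetrablock_zero_freeI:
  assumes "\<And>z. cmod z < 1 \<Longrightarrow> 1 - z * a \<noteq> 0 \<and> cmod (b - z * p) \<le> cmod (1 - z * a)"
  shows "tetrablock_zero_free a b p"
  unfolding tetrablock_zero_free_def
proof (intro allI impI notI)
  fix z w assume z: "cmod z < 1" and w: "cmod w < 1" and "1 - z * a - w * b + z * w * p = 0"
  then have "1 - z * a = w * (b - z * p)" by (simp add: algebra_simps)
  then have eq: "cmod (1 - z * a) = cmod w * cmod (b - z * p)" by (simp add: norm_mult)
  have pos: "cmod (1 - z * a) > 0" and le: "cmod (b - z * p) \<le> cmod (1 - z * a)"
    using assms[OF z] by auto
  have "cmod w * cmod (b - z * p) \<le> cmod w * cmod (1 - z * a)" using le by (intro mult_left_mono) auto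
  also have "\<dots> < 1 * cmod (1 - z * a)" using w pos by (intro mult_strict_right_mono)
  finally show False using eq by simp
qed

section \<open>Tetrablock points in the domain\<close>

text \<open>This is \<open>det (1 - A X)\<close> for \<open>X = diag (z, w, w)\<close>, when \<open>p\<close> consists of the coordinates of \<open>A\<close>.\<close>

definition E_polynomial :: "complex^5 \<Rightarrow> complex \<Rightarrow> complex \<Rightarrow> complex" where
  "E_polynomial p z w = (1 - z * p$1) - (p$4 - z * p$2) * w + (p$5 - z * p$3) * w\<^sup>2"

lemma onorm_diag_le:
  fixes X :: "complex^3^3"
  assumes X: "X = (\<chi> i j. if i = j then (if i = 1 then z else w) else 0)"
    and z: "cmod z \<le> r" and w: "cmod w \<le> r"
  shows "onorm (\<lambda>v. X *v v) \<le> r"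
proof (rule onorm_le)
  fix v :: "complex^3"
  have comp: "(X *v v) $ i = (if i = 1 then z else w) * v $ i" for i
    by (simp add: X matrix_vector_mult_def if_distrib[of "\<lambda>x. x * _"] cong: if_cong)
  have r: "r \<ge> 0" using z norm_ge_zero order_trans by blast
  have "norm (X *v v) \<le> norm (r *\<^sub>R v)"
  proof (rule norm_le_componentwise_cart)
    fix i show "norm ((X *v v) $ i) \<le> norm ((r *\<^sub>R v) $ i)"
      using z w r by (simp add: comp norm_mult mult_right_mono)
  qed
  then show "norm (X *v v) \<le> r * norm v" using r by simp
qed

text \<open>If \<open>det (1 - A Y) = 0\<close>, then \<open>A Y\<close> fixes a nonzero vector, so \<open>1 \<le> \<parallel>A\<parallel> \<parallel>Y\<parallel>\<close>. This lower bound keeps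
the infimum in \<open>mu_E\<close> away from zero; otherwise \<open>1 / 0 = 0\<close> would make the hypothesis vacuous.\<close>

lemma det_nonzero_of_mu_E_le_1:
  assumes mu: "mu_E A \<le> 1" and X: "X \<in> E_space" and less: "onorm (\<lambda>v. X *v v) < 1"
  shows "det (mat 1 - A ** X) \<noteq> 0"
proof
  assume zero: "det (mat 1 - A ** X) = 0"
  let ?S = "{onorm (\<lambda>v. X *v v) | X. X \<in> E_space \<and> det (mat 1 - A ** X) = 0}"
  define N where "N = onorm (\<lambda>v. A *v v)"
  have lin: "bounded_linear (\<lambda>v. Y *v v)" for Y :: "complex^3^3"
    by (rule matrix_vector_mul_bounded_linear)
  have one: "1 \<le> N * onorm (\<lambda>v. Y *v v)" if det0: "det (mat 1 - A ** Y) = 0" for Y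
  proof -
    have "\<not> invertible (mat 1 - A ** Y)" using det0 invertible_det_nz by blast
    then obtain v where v: "v \<noteq> 0" "(mat 1 - A ** Y) *v v = 0"
      using matrix_left_invertible_ker invertible_left_inverse by metis
    then have "A *v (Y *v v) = v" by (simp add: matrix_vector_mult_diff_rdistrib matrix_vector_mul_assoc)
    then have "norm v \<le> N * norm (Y *v v)" using onorm[OF lin[of A], of "Y *v v"] by (simp add: N_def)
    also have "\<dots> \<le> N * (onorm (\<lambda>v. Y *v v) * norm v)"
      using onorm[OF lin[of Y], of v] onorm_pos_le[OF lin[of A]] by (intro mult_left_mono) (simp_all add: N_def)
    finally have "1 * norm v \<le> (N * onorm (\<lambda>v. Y *v v)) * norm v" by simp
    then show ?thesis using v by (simp only: mult_le_cancel_right) simp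
  qed
  have "N \<ge> 0" unfolding N_def by (rule onorm_pos_le[OF lin])
  moreover have "N \<noteq> 0" using one[OF zero] by auto
  ultimately have N: "N > 0" by simp
  have lower: "1 / N \<le> s" if "s \<in> ?S" for s
    using that one N by (auto simp: divide_le_eq mult.commute)
  have mem: "onorm (\<lambda>v. X *v v) \<in> ?S" using X zero by blast
  then have "Inf ?S \<le> onorm (\<lambda>v. X *v v)" using lower by (intro cInf_lower bdd_belowI) 
  then have "Inf ?S < 1" using less by linarith
  moreover have "1 / N \<le> Inf ?S" using mem lower by (intro cInf_greatest) auto
  then have "Inf ?S > 0" using N less_le_trans[of 0 "1 / N"] by simp
  moreover have "mu_E A = 1 / Inf ?S" using X zero by (auto simp: mu_E_def)
  ultimately show False using mu by (simp add: divide_le_eq)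
qed

lemma Gamma_E_zero_free:
  assumes p: "p \<in> Gamma_E" and z: "cmod z < 1" and w: "cmod w < 1"
  shows "E_polynomial p z w \<noteq> 0"
proof -
  obtain A :: "complex^3^3" where A: "mu_E A \<le> 1"
    "p$1 = A$1$1"
    "p$2 = (A$1$1 * A$2$2 - A$1$2 * A$2$1) + (A$1$1 * A$3$3 - A$1$3 * A$3$1)"
    "p$3 = det A" "p$4 = A$2$2 + A$3$3" "p$5 = A$2$2 * A$3$3 - A$2$3 * A$3$2"
    using p unfolding Gamma_E_def by blast
  define X :: "complex^3^3" where "X = (\<chi> i j. if i = j then (if i = 1 then z else w) else 0)"
  have "onorm (\<lambda>v. X *v v) \<le> max (cmod z) (cmod w)"
    by (rule onorm_diag_le[OF X_def]) auto
  then have "onorm (\<lambda>v. X *v v) < 1" using z w by (simp add: max_def split: if_splits)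
  moreover have "X \<in> E_space" by (auto simp: E_space_def X_def)
  ultimately have "det (mat 1 - A ** X) \<noteq> 0" using det_nonzero_of_mu_E_le_1 A(1) by blast
  moreover have "det (mat 1 - A ** X) = E_polynomial p z w"
    by (simp add: E_polynomial_def A det_3 X_def matrix_matrix_mult_def sum_3 mat_def power2_eq_square
        algebra_simps)
  ultimately show ?thesis by simp
qed

text \<open>For fixed \<open>z\<close> the polynomial is a quadratic in \<open>w\<close>, whose leading and constant coefficients are
\<open>y\<^sub>2 - z x\<^sub>3\<close> and \<open>1 - z x\<^sub>1\<close>.\<close>

lemma Gamma_E_tetrablock_outer:
  assumes p: "p \<in> Gamma_E"
  shows "tetrablock_zero_free (p$1) (p$5) (p$3)"
  using Gamma_E_zero_free[OF p] unfolding E_polynomial_def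
  by (intro tetrablock_zero_freeI quadratic_zero_free_coeff)

text \<open>The coordinates \<open>x\<^sub>2\<close> and \<open>y\<^sub>1\<close> sit in the middle coefficient of that quadratic. Polarizing in \<open>w\<close>
gives a polynomial in three variables \<open>z, u, v\<close>, affine in each and without zeros in the polydisc,
in which \<open>u\<close> has the coefficient \<open>- y\<^sub>1 / 2\<close>, \<open>z v\<close> has \<open>x\<^sub>2 / 2\<close> and \<open>z u v\<close> has \<open>- x\<^sub>3\<close>. For fixed \<open>u\<close>
put \<open>z = v = t\<close> and compare the extreme coefficients of the resulting quadratic in \<open>t\<close>.\<close>

lemma Gamma_E_tetrablock_inner:
  assumes p: "p \<in> Gamma_E"
  shows "tetrablock_zero_free (p$4 / 2) (p$2 / 2) (p$3)"
proof (rule tetrablock_zero_freeI)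
  have polar: "(1 - z * p$1) - (p$4 - z * p$2) / 2 * (u + v) + (p$5 - z * p$3) * (u * v) \<noteq> 0"
    if z: "cmod z < 1" and u: "cmod u < 1" and v: "cmod v < 1" for z u v
  proof -
    obtain \<alpha> \<beta> where f: "1 - z * p$1 \<noteq> 0" "cmod \<alpha> \<le> 1" "cmod \<beta> \<le> 1"
      "p$4 - z * p$2 = (1 - z * p$1) * (\<alpha> + \<beta>)" "p$5 - z * p$3 = (1 - z * p$1) * (\<alpha> * \<beta>)"
      using quadratic_zero_free[of "1 - z * p$1" "p$4 - z * p$2" "p$5 - z * p$3"]
        Gamma_E_zero_free[OF p z] unfolding E_polynomial_def by metis
    have "(1 - z * p$1) - (p$4 - z * p$2) / 2 * (u + v) + (p$5 - z * p$3) * (u * v)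
        = (1 - z * p$1) * (1 - (\<alpha> + \<beta>) / 2 * (u + v) + \<alpha> * \<beta> * (u * v))"
      unfolding f(4,5) by (simp add: algebra_simps)
    then show ?thesis using f(1) polarized_quadratic_zero_free[OF f(2,3) u v] by simp
  qed
  fix u :: complex assume u: "cmod u < 1"
  have "(1 - u * (p$4 / 2)) - (p$1 + p$4 / 2 - u * (p$2 / 2) - u * p$5) * t
      + (p$2 / 2 - u * p$3) * t\<^sup>2 \<noteq> 0" if t: "cmod t < 1" for t
  proof -
    have eq: "(1 - u * (p$4 / 2)) - (p$1 + p$4 / 2 - u * (p$2 / 2) - u * p$5) * t
        + (p$2 / 2 - u * p$3) * t\<^sup>2
      = (1 - t * p$1) - (p$4 - t * p$2) / 2 * (u + t) + (p$5 - t * p$3) * (u * t)"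
      by (simp add: field_simps power2_eq_square)
    show ?thesis unfolding eq by (rule polar[OF t u t])
  qed
  then show "1 - u * (p$4 / 2) \<noteq> 0 \<and> cmod (p$2 / 2 - u * p$3) \<le> cmod (1 - u * (p$4 / 2))"
    by (rule quadratic_zero_free_coeff)
qed

section \<open>Functional calculus estimates\<close>

lemma holomorphic_several_const: "holomorphic_several (\<lambda>z. c) U"
  unfolding holomorphic_several_def by (intro ballI exI[of _ "\<lambda>v. 0"]) simp

lemma holomorphic_several_coordinate: "holomorphic_several (\<lambda>z. z $ i) U"
  unfolding holomorphic_several_def
  by (intro ballI exI[of _ "\<lambda>v. v $ i"])
    (simp add: bounded_linear_imp_has_derivative bounded_linear_vec_nth)

lemma holomorphic_several_add:
  assumes "holomorphic_several f U" "holomorphic_several g U"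
  shows "holomorphic_several (\<lambda>z. f z + g z) U"
  unfolding holomorphic_several_def
proof
  fix z assume z: "z \<in> U"
  obtain f' g' where "(f has_derivative f') (at z)" "\<forall>c v. f' (c *s v) = c * f' v"
    "(g has_derivative g') (at z)" "\<forall>c v. g' (c *s v) = c * g' v"
    using assms z unfolding holomorphic_several_def by metis
  then show "\<exists>h. ((\<lambda>z. f z + g z) has_derivative h) (at z) \<and> (\<forall>c v. h (c *s v) = c * h v)"
    by (intro exI[of _ "\<lambda>v. f' v + g' v"] conjI has_derivative_add) (simp_all add: distrib_left)
qed

lemma holomorphic_several_mult:
  assumes "holomorphic_several f U" "holomorphic_several g U"
  shows "holomorphic_several (\<lambda>z. f z * g z) U"
  unfolding holomorphic_several_def
proof
  fix z assume z: "z \<in> U"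
  obtain f' g' where "(f has_derivative f') (at z)" "\<forall>c v. f' (c *s v) = c * f' v"
    "(g has_derivative g') (at z)" "\<forall>c v. g' (c *s v) = c * g' v"
    using assms z unfolding holomorphic_several_def by metis
  then show "\<exists>h. ((\<lambda>z. f z * g z) has_derivative h) (at z) \<and> (\<forall>c v. h (c *s v) = c * h v)"
    by (intro exI[of _ "\<lambda>v. f z * g' v + f' v * g z"] conjI has_derivative_mult)
      (simp_all add: algebra_simps)
qed

lemma holomorphic_several_divide:
  assumes "holomorphic_several f U" "holomorphic_several g U" and nz: "\<And>z. z \<in> U \<Longrightarrow> g z \<noteq> 0"
  shows "holomorphic_several (\<lambda>z. f z / g z) U"
  unfolding holomorphic_several_def
proof
  fix z assume z: "z \<in> U"
  obtain f' g' where "(f has_derivative f') (at z)" "\<forall>c v. f' (c *s v) = c * f' v"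
    "(g has_derivative g') (at z)" "\<forall>c v. g' (c *s v) = c * g' v"
    using assms z unfolding holomorphic_several_def by metis
  then show "\<exists>h. ((\<lambda>z. f z / g z) has_derivative h) (at z) \<and> (\<forall>c v. h (c *s v) = c * h v)"
    by (intro exI[of _ "\<lambda>v. (f' v * g z - f z * g' v) / (g z * g z)"] conjI
        has_derivative_divide' nz z) (simp_all add: algebra_simps)
qed

lemma holomorphic_several_subset:
  "holomorphic_several f U \<Longrightarrow> V \<subseteq> U \<Longrightarrow> holomorphic_several f V"
  unfolding holomorphic_several_def by auto

lemma holomorphic_several_continuous:
  assumes "holomorphic_several f UNIV" shows "continuous_on UNIV f"
  using assms unfolding holomorphic_several_def
  by (intro continuous_at_imp_continuous_on) (auto intro: has_derivative_continuous)

lemma holomorphic_near_UNIV: "holomorphic_several f UNIV \<Longrightarrow> holomorphic_near f K"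
  unfolding holomorphic_near_def by (rule exI[of _ UNIV]) simp

lemma holomorphic_near_subset: "holomorphic_near f K \<Longrightarrow> L \<subseteq> K \<Longrightarrow> holomorphic_near f L"
  unfolding holomorphic_near_def by (meson order_trans)

lemma taylor_calculus_bounded:
  "taylor_calculus T \<Phi> \<Longrightarrow> holomorphic_near f (taylor_spectrum T) \<Longrightarrow> bounded_op (\<Phi> f)"
  unfolding taylor_calculus_def by (elim conjE) (rule allE, assumption, erule mp)

lemma taylor_calculus_add:
  "taylor_calculus T \<Phi> \<Longrightarrow> holomorphic_near f (taylor_spectrum T) \<Longrightarrow>
    holomorphic_near g (taylor_spectrum T) \<Longrightarrow> \<Phi> (\<lambda>z. f z + g z) = (\<lambda>x. \<Phi> f x + \<Phi> g x)"
  unfolding taylor_calculus_def by (elim conjE) (simp only: )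

lemma taylor_calculus_mult:
  "taylor_calculus T \<Phi> \<Longrightarrow> holomorphic_near f (taylor_spectrum T) \<Longrightarrow>
    holomorphic_near g (taylor_spectrum T) \<Longrightarrow> \<Phi> (\<lambda>z. f z * g z) = \<Phi> f \<circ> \<Phi> g"
  unfolding taylor_calculus_def by (elim conjE) (simp only: )

lemma taylor_calculus_const: "taylor_calculus T \<Phi> \<Longrightarrow> \<Phi> (\<lambda>z. c) = scaleC c"
  and taylor_calculus_coordinate: "taylor_calculus T \<Phi> \<Longrightarrow> \<Phi> (\<lambda>z. z $ i) = T i"
  unfolding taylor_calculus_def by (elim conjE, simp only: )+

lemma taylor_calculus_monomial:
  assumes "taylor_calculus T \<Phi>"
  shows "\<Phi> (\<lambda>z. c * z $ i) = (\<lambda>x. scaleC c (T i x))"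
  using taylor_calculus_mult[OF assms holomorphic_near_UNIV[OF holomorphic_several_const]
      holomorphic_near_UNIV[OF holomorphic_several_coordinate], of c i]
  by (simp add: taylor_calculus_const[OF assms] taylor_calculus_coordinate[OF assms] comp_def)

text \<open>Equality on a neighbourhood gives equal values: this is the continuity of the calculus for a constant
sequence.\<close>

lemma taylor_calculus_germ:
  assumes calc: "taylor_calculus T \<Phi>" and U: "open U" "taylor_spectrum T \<subseteq> U"
    and f: "holomorphic_several f U" and g: "holomorphic_several g U"
    and eq: "\<And>z. z \<in> U \<Longrightarrow> f z = g z"
  shows "\<Phi> f = \<Phi> g"
proof -
  have cont: "\<forall>U f F. open U \<longrightarrow> taylor_spectrum T \<subseteq> U \<longrightarrow>
        holomorphic_several f U \<longrightarrow> (\<forall>k::nat. holomorphic_several (F k) U) \<longrightarrow>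
        (\<forall>C. compact C \<longrightarrow> C \<subseteq> U \<longrightarrow> uniform_limit C F f sequentially) \<longrightarrow>
        (\<lambda>k. onorm (\<lambda>x. \<Phi> (F k) x - \<Phi> f x)) \<longlonglongrightarrow> 0"
    using calc unfolding taylor_calculus_def by (elim conjE) assumption
  have unif: "uniform_limit C (\<lambda>k::nat. f) g sequentially" if "C \<subseteq> U" for C
    unfolding uniform_limit_iff using that eq by (auto simp: subset_iff)
  have "(\<lambda>k::nat. onorm (\<lambda>x. \<Phi> f x - \<Phi> g x)) \<longlonglongrightarrow> 0"
    using cont[rule_format, OF U g, of "\<lambda>k. f"] f unif by simp
  then have zero: "onorm (\<lambda>x. \<Phi> f x - \<Phi> g x) = 0" by (simp add: LIMSEQ_const_iff)
  have near: "holomorphic_near f (taylor_spectrum T)" "holomorphic_near g (taylor_spectrum T)"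
    unfolding holomorphic_near_def using U f g by blast+
  have "bounded_linear (\<lambda>x. \<Phi> f x - \<Phi> g x)"
    by (intro bounded_op_bounded_linear bounded_op_sub taylor_calculus_bounded[OF calc] near)
  then show ?thesis using zero by (simp add: onorm_eq_0 fun_eq_iff)
qed

text \<open>The quotient \<open>f = num / den\<close> is holomorphic near \<open>K\<close> and bounded by \<open>1\<close> there, so \<open>\<Phi> f\<close> is a
contraction and \<open>\<Phi> num = \<Phi> f \<circ> \<Phi> den\<close>. The equation \<open>num = f den\<close> fails at zeros of \<open>den\<close>, where the
quotient is \<open>0\<close> by convention; therefore the comparison is made on germs.\<close>

lemma spectral_set_fraction_bound:
  fixes T :: "'n::{finite,linorder} \<Rightarrow> 'a::complex_hilbert \<Rightarrow> 'a"
  assumes calc: "taylor_calculus T \<Phi>" and sub: "taylor_spectrum T \<subseteq> K"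
    and contr: "\<And>f. holomorphic_near f K \<Longrightarrow> ereal (onorm (\<Phi> f)) \<le> (SUP z\<in>K. ereal (cmod (f z)))"
    and num: "holomorphic_several num UNIV" and den: "holomorphic_several den UNIV"
    and nz: "\<And>z. z \<in> K \<Longrightarrow> den z \<noteq> 0" and le: "\<And>z. z \<in> K \<Longrightarrow> cmod (num z) \<le> cmod (den z)"
  shows "norm (\<Phi> num x) \<le> norm (\<Phi> den x)"
proof -
  define U where "U = {z. den z \<noteq> 0}"
  define f where "f z = num z / den z" for z
  have U: "open U" "K \<subseteq> U"
    using nz holomorphic_several_continuous[OF den]
    by (auto simp: U_def intro!: open_Collect_neq)
  have f: "holomorphic_several f U"
    unfolding f_def
    by (intro holomorphic_several_divide holomorphic_several_subset[OF num]
        holomorphic_several_subset[OF den]) (auto simp: U_def)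
  have fK: "holomorphic_near f K" using U f unfolding holomorphic_near_def by blast
  note fT = holomorphic_near_subset[OF fK sub]
  have "(SUP z\<in>K. ereal (cmod (f z))) \<le> ereal 1"
    using le nz by (intro SUP_least) (simp add: f_def norm_divide divide_le_eq)
  from order_trans[OF contr[OF fK] this] have one: "onorm (\<Phi> f) \<le> 1" by simp
  have "\<Phi> num = \<Phi> (\<lambda>z. f z * den z)"
  proof (rule taylor_calculus_germ[OF calc U(1) order_trans[OF sub U(2)]])
    show "holomorphic_several num U" by (rule holomorphic_several_subset[OF num]) simp
    show "holomorphic_several (\<lambda>z. f z * den z) U"
      by (rule holomorphic_several_mult[OF f holomorphic_several_subset[OF den]]) simp
  qed (simp add: f_def U_def)
  also have "\<dots> = \<Phi> f \<circ> \<Phi> den"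
    by (rule taylor_calculus_mult[OF calc fT holomorphic_near_UNIV[OF den]])
  finally have "norm (\<Phi> num x) = norm (\<Phi> f (\<Phi> den x))" by simp
  also have "\<dots> \<le> onorm (\<Phi> f) * norm (\<Phi> den x)"
    by (rule onorm[OF bounded_op_bounded_linear[OF taylor_calculus_bounded[OF calc fT]]])
  also have "\<dots> \<le> 1 * norm (\<Phi> den x)" by (intro mult_right_mono one) simp
  finally show ?thesis by simp
qed

lemma spectral_set_contractive_pair:
  fixes T :: "'n::{finite,linorder} \<Rightarrow> 'a::complex_hilbert \<Rightarrow> 'a"
  assumes K: "spectral_set K T" and bounded: "\<And>i. bounded_op (T i)"
    and comm: "\<And>i j. T i \<circ> T j = T j \<circ> T i"
    and tetra: "\<And>p. p \<in> K \<Longrightarrow> tetrablock_zero_free (d * p $ i) (d * p $ j) (p $ k)"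
  shows "contractive_pair (\<lambda>x. scaleC d (T i x)) (\<lambda>x. scaleC d (T j x)) (T k)"
proof -
  obtain \<Phi> where calc: "taylor_calculus T \<Phi>" and sub: "taylor_spectrum T \<subseteq> K"
    and contr: "\<And>f. holomorphic_near f K \<Longrightarrow> ereal (onorm (\<Phi> f)) \<le> (SUP z\<in>K. ereal (cmod (f z)))"
    using K unfolding spectral_set_def by blast
  note hol = holomorphic_several_add holomorphic_several_mult holomorphic_several_const
    holomorphic_several_coordinate
  have monomial: "holomorphic_near (\<lambda>p. c * p $ i) L"
    for c :: complex and i :: 'n and L
    by (intro holomorphic_near_UNIV hol)
  have bound: "norm (scaleC d (T j x) - scaleC z (T k x)) \<le> norm (x - scaleC z (scaleC d (T i x)))"
    if z: "cmod z < 1" and tetra: "\<And>p. p \<in> K \<Longrightarrow> tetrablock_zero_free (d * p $ i) (d * p $ j) (p $ k)"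
    for z x i j
  proof -
    define num where "num p = d * p $ j + (- z) * p $ k" for p
    define den where "den p = 1 + (- z * d) * p $ i" for p
    have "norm (\<Phi> num x) \<le> norm (\<Phi> den x)"
    proof (rule spectral_set_fraction_bound[OF calc sub contr])
      show "holomorphic_several num UNIV" "holomorphic_several den UNIV"
        unfolding num_def den_def by (intro hol)+
      fix p assume "p \<in> K"
      from tetrablock_zero_free_bound[OF tetra[OF this] z]
      show "den p \<noteq> 0" "cmod (num p) \<le> cmod (den p)"
        by (simp_all add: num_def den_def mult.assoc)
    qed
    moreover have "\<Phi> num = (\<lambda>x. scaleC d (T j x) + scaleC (- z) (T k x))"
      unfolding num_def taylor_calculus_add[OF calc monomial monomial]
      by (simp only: taylor_calculus_monomial[OF calc])
    moreover have "\<Phi> den = (\<lambda>x. scaleC 1 x + scaleC (- z * d) (T i x))"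
      unfolding den_def
        taylor_calculus_add[OF calc holomorphic_near_UNIV[OF holomorphic_several_const] monomial]
      by (simp only: taylor_calculus_monomial[OF calc] taylor_calculus_const[OF calc])
    ultimately show ?thesis

      by (simp add: scaleC_minus_left scaleC_scaleC)
  qed
  have Tk: "T i' (T k x) = T k (T i' x)" for i' x using fun_cong[OF comm[of i' k], of x] by simp
  show ?thesis
  proof (unfold_locales)
    fix z :: complex and x assume z: "cmod z < 1"
    show "norm (scaleC d (T i x) - scaleC z (T k x)) \<le> norm (x - scaleC z (scaleC d (T j x)))"
      by (rule bound[OF z tetrablock_zero_free_commute[OF tetra]])
    show "norm (scaleC d (T j x) - scaleC z (T k x)) \<le> norm (x - scaleC z (scaleC d (T i x)))"
      by (rule bound[OF z tetra])
  qed (simp_all add: bounded bounded_op_scale bounded_op_scaleC[OF bounded] Tk)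
qed

lemma tuple5_simps:
  "tuple5 a b c d e 1 = a" "tuple5 a b c d e 2 = b" "tuple5 a b c d e 3 = c"
  "tuple5 a b c d e 4 = d" "tuple5 a b c d e 5 = e"
  by (simp_all add: tuple5_def)

section \<open>The two pairs of a contraction\<close>

text \<open>The coordinates \<open>(x\<^sub>1, y\<^sub>2, x\<^sub>3)\<close> and \<open>(x\<^sub>2 / 2, y\<^sub>1 / 2, x\<^sub>3)\<close> are points of the tetrablock; the pairs
below are the corresponding operators.\<close>

lemma Gamma_E_contraction_pairs:
  assumes "Gamma_E_contraction S1 S2 S3 St1 St2"
  shows "contractive_pair S1 St2 S3"
    and "contractive_pair (\<lambda>x. scaleC (1/2) (S2 x)) (\<lambda>x. scaleC (1/2) (St1 x)) S3"
    and "bounded_op S2" "bounded_op St1"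
proof -
  define T where "T = tuple5 S1 S2 S3 St1 St2"
  have K: "spectral_set Gamma_E T" and b: "\<And>i. bounded_op (T i)"
    and c: "\<And>i j. T i \<circ> T j = T j \<circ> T i"
    using assms unfolding Gamma_E_contraction_def Let_def T_def by blast+
  have T: "T 1 = S1" "T 2 = S2" "T 3 = S3" "T 4 = St1" "T 5 = St2"
    by (simp_all only: T_def tuple5_simps)
  show "contractive_pair S1 St2 S3"
    using spectral_set_contractive_pair[OF K b c, of 1 1 5 3] Gamma_E_tetrablock_outer
    by (simp add: T)
  show "contractive_pair (\<lambda>x. scaleC (1/2) (S2 x)) (\<lambda>x. scaleC (1/2) (St1 x)) S3"
    using spectral_set_contractive_pair[OF K b c, of "1/2" 2 4 3]
      tetrablock_zero_free_commute[OF Gamma_E_tetrablock_inner]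
    by (simp add: T)
  show "bounded_op S2" "bounded_op St1" using b[of 2] b[of 4] by (simp_all only: T)
qed

theorem lemma2p9:
  fixes S1 S2 S3 St1 St2 :: "'a::complex_hilbert \<Rightarrow> 'a"
  assumes "Gamma_E_contraction S1 S2 S3 St1 St2"
  shows "\<exists>G1 Gt2 G2 Gt1.
    fundamental_operators S1 S2 S3 St1 St2 G1 Gt2 G2 Gt1 \<and>
    (let D = defect_op S3; M = defect_space S3 in
      \<forall>F1 Ft2 F2 Ft1.
        {F1, Ft2, F2, Ft1} \<subseteq> bounded_ops M \<and>
        (\<forall>x. D (S1 x) = F1 (D x) + adj_on M Ft2 (D (S3 x)) \<and>
             D (St2 x) = Ft2 (D x) + adj_on M F1 (D (S3 x)) \<and>
             D (scaleC (1/2) (S2 x)) = F2 (D x) + adj_on M Ft1 (D (S3 x)) \<and>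
             D (scaleC (1/2) (St1 x)) = Ft1 (D x) + adj_on M F2 (D (S3 x)))
        \<longleftrightarrow> F1 = G1 \<and> Ft2 = Gt2 \<and> F2 = G2 \<and> Ft1 = Gt1)"
proof -
  note pairs = Gamma_E_contraction_pairs[OF assms]
  interpret outer: contractive_pair S1 St2 S3 by (rule pairs(1))
  interpret inner: contractive_pair "\<lambda>x. scaleC (1/2) (S2 x)" "\<lambda>x. scaleC (1/2) (St1 x)" S3
    by (rule pairs(2))
  let ?D = "defect_op S3" and ?M = "defect_space S3"
  have half_adj: "adj (\<lambda>x. scaleC (1/2) (S2 x)) y = scaleC (1/2) (adj S2 y)"
    "adj (\<lambda>x. scaleC (1/2) (St1 x)) y = scaleC (1/2) (adj St1 y)" for y
    using adj_scale[OF pairs(3), of "1/2"] adj_scale[OF pairs(4), of "1/2"] by simp_all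
  obtain G1 where G1: "G1 \<in> bounded_ops ?M" "\<forall>x. S1 x - adj St2 (S3 x) = ?D (G1 (?D x))"
    using outer.fundamental_exist(1) by (rule bexE)
  obtain Gt2 where Gt2: "Gt2 \<in> bounded_ops ?M" "\<forall>x. St2 x - adj S1 (S3 x) = ?D (Gt2 (?D x))"
    using outer.fundamental_exist(2) by (rule bexE)
  obtain G2 where G2: "G2 \<in> bounded_ops ?M"
    "\<forall>x. scaleC (1/2) (S2 x) - scaleC (1/2) (adj St1 (S3 x)) = ?D (G2 (?D x))"
    using inner.fundamental_exist(1) unfolding half_adj by (rule bexE)
  obtain Gt1 where Gt1: "Gt1 \<in> bounded_ops ?M"
    "\<forall>x. scaleC (1/2) (St1 x) - scaleC (1/2) (adj S2 (S3 x)) = ?D (Gt1 (?D x))"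
    using inner.fundamental_exist(2) unfolding half_adj by (rule bexE)
  have unique: "{F1, Ft2, F2, Ft1} \<subseteq> bounded_ops ?M \<and>
        fundamental_eqs S1 S2 S3 St1 St2 F1 Ft2 F2 Ft1
        \<longleftrightarrow> F1 = G1 \<and> Ft2 = Gt2 \<and> F2 = G2 \<and> Ft1 = Gt1" for F1 Ft2 F2 Ft1
  proof
    assume "{F1, Ft2, F2, Ft1} \<subseteq> bounded_ops ?M \<and> fundamental_eqs S1 S2 S3 St1 St2 F1 Ft2 F2 Ft1"
    then have mem: "F1 \<in> bounded_ops ?M" "Ft2 \<in> bounded_ops ?M" "F2 \<in> bounded_ops ?M"
        "Ft1 \<in> bounded_ops ?M"
      and eqs: "\<And>x. ?D (F1 (?D x)) = ?D (G1 (?D x))" "\<And>x. ?D (Ft2 (?D x)) = ?D (Gt2 (?D x))"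
        "\<And>x. ?D (F2 (?D x)) = ?D (G2 (?D x))" "\<And>x. ?D (Ft1 (?D x)) = ?D (Gt1 (?D x))"
      using G1(2) Gt2(2) G2(2) Gt1(2) unfolding fundamental_eqs_def Let_def by simp_all
    show "F1 = G1 \<and> Ft2 = Gt2 \<and> F2 = G2 \<and> Ft1 = Gt1"
      by (intro conjI outer.eq_on_defect_space mem eqs G1(1) Gt2(1) G2(1) Gt1(1))
  next
    assume "F1 = G1 \<and> Ft2 = Gt2 \<and> F2 = G2 \<and> Ft1 = Gt1"
    then show "{F1, Ft2, F2, Ft1} \<subseteq> bounded_ops ?M \<and> fundamental_eqs S1 S2 S3 St1 St2 F1 Ft2 F2 Ft1"
      using G1 Gt2 G2 Gt1 unfolding fundamental_eqs_def Let_def by simp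
  qed
  have equiv: "fundamental_eqs S1 S2 S3 St1 St2 F1 Ft2 F2 Ft1 \<longleftrightarrow>
      (\<forall>x. ?D (S1 x) = F1 (?D x) + adj_on ?M Ft2 (?D (S3 x)) \<and>
           ?D (St2 x) = Ft2 (?D x) + adj_on ?M F1 (?D (S3 x)) \<and>
           ?D (scaleC (1/2) (S2 x)) = F2 (?D x) + adj_on ?M Ft1 (?D (S3 x)) \<and>
           ?D (scaleC (1/2) (St1 x)) = Ft1 (?D x) + adj_on ?M F2 (?D (S3 x)))"
    if "{F1, Ft2, F2, Ft1} \<subseteq> bounded_ops ?M" for F1 Ft2 F2 Ft1
  proof -
    have mem: "F1 \<in> bounded_ops ?M" "Ft2 \<in> bounded_ops ?M" "F2 \<in> bounded_ops ?M"
        "Ft1 \<in> bounded_ops ?M" using that by simp_all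
    note e1 = outer.equations_iff[OF mem(1,2)]
      and e2 = inner.equations_iff[OF mem(3,4), unfolded half_adj]
    have "fundamental_eqs S1 S2 S3 St1 St2 F1 Ft2 F2 Ft1 \<longleftrightarrow>
      (\<forall>x. S1 x - adj St2 (S3 x) = ?D (F1 (?D x)) \<and> St2 x - adj S1 (S3 x) = ?D (Ft2 (?D x))) \<and>
      (\<forall>x. scaleC (1/2) (S2 x) - scaleC (1/2) (adj St1 (S3 x)) = ?D (F2 (?D x)) \<and>
        scaleC (1/2) (St1 x) - scaleC (1/2) (adj S2 (S3 x)) = ?D (Ft1 (?D x)))"
      unfolding fundamental_eqs_def Let_def by iprover
    then show ?thesis unfolding e1 e2 by iprover
  qed
  show ?thesis
    unfolding Let_def fundamental_operators_def
    by (intro exI[of _ G1] exI[of _ Gt2] exI[of _ G2] exI[of _ Gt1] conjI allI)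
      (rule unique, rule trans[OF conj_cong unique], rule refl, rule equiv[symmetric])
qed

end
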